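(* Let $n\ge 2$, $k\ge 2$ be integers and let $p_{i,j}=p_{j,i}\in\{2,3,\dots\}\cup\{\infty\}$ for $1\le i<j\le n-1$. Let $G$ be the Shephard group with generating set $S=\{a_0,a_1,\dots,a_{n-1}\}$ and relations: $a_0^k=1$; $a_0a_i=a_ia_0$ for $2\le i\le n-1$; and $(a_ia_j)_{p_{i,j}}=(a_ja_i)_{p_{i,j}}$ for $1\le i<j\le n-1$ with $p_{i,j}\ne\infty$ (there is no relation between $a_0$ and $a_1$, and $a_1,\dots,a_{n-1}$ have no order relation). Then, for all $J,K,L\subseteq S$: (a) $\langle J\rangle\cap\langle K\rangle=\langle J\cap K\rangle$; (b) $\langle J\rangle\langle K\rangle\cap\langle J\rangle\langle L\rangle=\langle J\rangle(\langle K\rangle\cap\langle L\rangle)$; (c) the simplicial complex $\mathcal K(G,(G_i)_{i\in I})$ is a flag complex, where $I=\{0,\dots,n-1\}$ and $G_i=\langle a_j\mid j\in I\setminus\{i\}\rangle$.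
   Context: $(ab)_m$ denotes the alternating word $aba\cdots$ with $m$ factors. Products such as $\langle J\rangle\langle K\rangle$ are sets of products of elements. The coset complex $\mathcal K(G,(G_i)_{i\in I})$ is the abstract simplicial complex with vertices the left cosets $gG_i$, $g\in G$, $i\in I$ (cosets of different types $i$ are different vertices), a set $\{g_1G_{i_1},\dots,g_mG_{i_m}\}$ of vertices being a simplex iff $g_1G_{i_1}\cap\dots\cap g_mG_{i_m}\neq\emptyset$. A simplicial complex is a flag complex if every set of vertices that are pairwise joined by edges is a simplex. *)

theory Defs
  imports "HOL-Algebra.Generated_Groups" "HOL-Library.Extended_Nat"
begin

section \<open>Groups given by generators and relations\<close>

text \<open>A letter \<open>(x, True)\<close> stands for the generator \<open>x\<close>, a letter \<open>(x, False)\<close> for its formal inverse.\<close>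

type_synonym 'a gword = "('a \<times> bool) list"

definition words :: "'a set \<Rightarrow> 'a gword set" where
  "words X = lists (X \<times> UNIV)"

text \<open>The least congruence on words over \<open>X\<close> that makes formal inverses inverse and identifies
  the two sides of each relation \<open>(l, r) \<in> R\<close>.\<close>

inductive pres_eq :: "'a set \<Rightarrow> ('a gword \<times> 'a gword) set \<Rightarrow> 'a gword \<Rightarrow> 'a gword \<Rightarrow> bool"
  for X R where
    refl:   "u \<in> words X \<Longrightarrow> pres_eq X R u u"
  | sym:    "pres_eq X R u v \<Longrightarrow> pres_eq X R v u"
  | trans:  "pres_eq X R u v \<Longrightarrow> pres_eq X R v w \<Longrightarrow> pres_eq X R u w"
  | cancel: "x \<in> X \<Longrightarrow> pres_eq X R [(x, b), (x, \<not> b)] []"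
  | rel:    "(l, r) \<in> R \<Longrightarrow> l \<in> words X \<Longrightarrow> r \<in> words X \<Longrightarrow> pres_eq X R l r"
  | mult:   "pres_eq X R u u' \<Longrightarrow> pres_eq X R v v' \<Longrightarrow> pres_eq X R (u @ v) (u' @ v')"

definition pres_rel :: "'a set \<Rightarrow> ('a gword \<times> 'a gword) set \<Rightarrow> ('a gword \<times> 'a gword) set" where
  "pres_rel X R = {(u, v). pres_eq X R u v}"

definition presented_group :: "'a set \<Rightarrow> ('a gword \<times> 'a gword) set \<Rightarrow> 'a gword set monoid" where
  "presented_group X R = \<lparr>
     carrier = words X // pres_rel X R,
     mult = (\<lambda>A B. \<Union>u\<in>A. \<Union>v\<in>B. pres_rel X R `` {u @ v}),
     one = pres_rel X R `` {[]}\<rparr>"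

definition pres_gen :: "'a set \<Rightarrow> ('a gword \<times> 'a gword) set \<Rightarrow> 'a \<Rightarrow> 'a gword set" where
  "pres_gen X R x = pres_rel X R `` {[(x, True)]}"

lemma words_simps [simp]:
  "[] \<in> words X"
  "(x, b) # u \<in> words X \<longleftrightarrow> x \<in> X \<and> u \<in> words X"
  "u @ v \<in> words X \<longleftrightarrow> u \<in> words X \<and> v \<in> words X"
  by (auto simp: words_def)

lemma pres_eq_words: "pres_eq X R u v \<Longrightarrow> u \<in> words X \<and> v \<in> words X"
  by (induction rule: pres_eq.induct) auto

lemma equiv_pres_rel: "equiv (words X) (pres_rel X R)"
  by (rule equivI)
     (auto simp: pres_rel_def refl_on_def sym_def trans_def dest: pres_eq_words
           intro: pres_eq.refl pres_eq.sym pres_eq.trans)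

lemma pres_mult_class:
  assumes "u \<in> words X" "v \<in> words X"
  shows "pres_rel X R `` {u} \<otimes>\<^bsub>presented_group X R\<^esub> pres_rel X R `` {v} = pres_rel X R `` {u @ v}"
proof -
  have "congruent2 (pres_rel X R) (pres_rel X R) (\<lambda>u v. pres_rel X R `` {u @ v})"
    by (rule congruent2I', rule equiv_class_eq[OF equiv_pres_rel])
       (auto simp: pres_rel_def intro: pres_eq.mult)
  from UN_equiv_class2[OF equiv_pres_rel equiv_pres_rel this assms]
  show ?thesis by (simp add: presented_group_def)
qed

lemma pres_carrier: "carrier (presented_group X R) = (\<lambda>u. pres_rel X R `` {u}) ` words X"
  by (auto simp: presented_group_def quotient_def)

lemma pres_one: "\<one>\<^bsub>presented_group X R\<^esub> = pres_rel X R `` {[]}"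
  by (simp add: presented_group_def)

lemma pres_left_inverse:
  assumes "u \<in> words X"
  shows "\<exists>v \<in> words X. pres_eq X R (v @ u) []"
  using assms
proof (induction u)
  case Nil
  then show ?case by (auto intro!: bexI[of _ "[]"] pres_eq.refl)
next
  case (Cons y u)
  obtain x b where y: "y = (x, b)" by (cases y)
  with Cons obtain v where x: "x \<in> X" and v: "v \<in> words X" "pres_eq X R (v @ u) []" "u \<in> words X"
    by auto
  have "pres_eq X R [(x, \<not> b), (x, b)] []"
    using pres_eq.cancel[OF x, of R "\<not> b"] by simp
  then have "pres_eq X R (v @ ([(x, \<not> b), (x, b)] @ u)) (v @ ([] @ u))"
    using v by (intro pres_eq.mult pres_eq.refl)
  with v(2) have "pres_eq X R ((v @ [(x, \<not> b)]) @ y # u) []"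
    by (auto simp: y intro: pres_eq.trans)
  with v(1) x show ?case by (intro bexI[of _ "v @ [(x, \<not> b)]"]) auto
qed

lemma group_presented_group: "group (presented_group X R)"
proof (rule groupI)
  fix A assume "A \<in> carrier (presented_group X R)"
  then obtain u where u: "u \<in> words X" "A = pres_rel X R `` {u}" by (auto simp: pres_carrier)
  from pres_left_inverse[OF u(1)] obtain v where v: "v \<in> words X" "pres_eq X R (v @ u) []" by blast
  have "pres_rel X R `` {v @ u} = pres_rel X R `` {[]}"
    using v(2) by (intro equiv_class_eq[OF equiv_pres_rel]) (simp add: pres_rel_def)
  with u v(1) show "\<exists>B\<in>carrier (presented_group X R). B \<otimes>\<^bsub>presented_group X R\<^esub> A = \<one>\<^bsub>presented_group X R\<^esub>"
    by (auto simp: pres_carrier pres_one pres_mult_class)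
qed (auto simp: pres_carrier pres_one pres_mult_class)

lemma pres_gen_closed: "x \<in> X \<Longrightarrow> pres_gen X R x \<in> carrier (presented_group X R)"
  by (auto simp: pres_gen_def pres_carrier)

text \<open>The universal property of the presentation.\<close>

definition word_eval :: "('b, 'c) monoid_scheme \<Rightarrow> ('a \<Rightarrow> 'b) \<Rightarrow> 'a gword \<Rightarrow> 'b" where
  "word_eval H f u =
     foldr (\<lambda>(x, b) h. (if b then f x else inv\<^bsub>H\<^esub> f x) \<otimes>\<^bsub>H\<^esub> h) u \<one>\<^bsub>H\<^esub>"

lemma presented_group_universal:
  assumes H: "group H" and f: "f \<in> X \<rightarrow> carrier H"
    and R: "\<And>l r. (l, r) \<in> R \<Longrightarrow> word_eval H f l = word_eval H f r"
  shows "\<exists>h \<in> hom (presented_group X R) H. \<forall>x\<in>X. h (pres_gen X R x) = f x"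
proof -
  interpret H: group H by fact
  let ?e = "word_eval H f"
  have closed: "?e u \<in> carrier H" if "u \<in> words X" for u
    using that f by (induction u) (auto simp: word_eval_def Pi_iff)
  have app: "?e (u @ v) = ?e u \<otimes>\<^bsub>H\<^esub> ?e v" if "u \<in> words X" "v \<in> words X" for u v
    using that(1)
  proof (induction u)
    case Nil
    then show ?case using closed[OF that(2)] by (simp add: word_eval_def)
  next
    case (Cons y u)
    then show ?case using closed[OF that(2)] closed[of u] f
      by (cases y) (auto simp: word_eval_def H.m_assoc Pi_iff)
  qed
  have resp: "?e u = ?e v" if "pres_eq X R u v" for u v
    using that
  proof (induction rule: pres_eq.induct)
    case (cancel x b)
    then show ?case using f by (auto simp: word_eval_def Pi_iff)
  next
    case (mult u u' v v')
    then show ?case using pres_eq_words by (metis app)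
  qed (auto simp: R)
  define h where "h A = (THE y. \<forall>u\<in>A. y = ?e u)" for A
  have h: "h (pres_rel X R `` {u}) = ?e u" if "u \<in> words X" for u
    unfolding h_def
  proof (rule the_equality)
    show "\<forall>v\<in>pres_rel X R `` {u}. ?e u = ?e v" by (auto simp: pres_rel_def dest: resp)
    show "y = ?e u" if "\<forall>v\<in>pres_rel X R `` {u}. y = ?e v" for y
      using that pres_eq.refl[OF \<open>u \<in> words X\<close>] by (auto simp: pres_rel_def)
  qed
  have "h \<in> hom (presented_group X R) H"
    by (rule homI) (auto simp: pres_carrier pres_mult_class h closed app)
  moreover have "\<forall>x\<in>X. h (pres_gen X R x) = f x"
    using f by (auto simp: pres_gen_def h word_eval_def Pi_iff)
  ultimately show ?thesis by blast
qed

section \<open>Shephard groups\<close>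

fun alt_word :: "'a \<Rightarrow> 'a \<Rightarrow> nat \<Rightarrow> 'a gword" where
  "alt_word a b 0 = []"
| "alt_word a b (Suc m) = (a, True) # alt_word b a m"

text \<open>The generating symbol \<open>i\<close> stands for \<open>a\<^sub>i\<close>. No braid relation is imposed
  for a pair with \<open>p i j = \<infinity>\<close>.\<close>

definition shephard_relations :: "nat \<Rightarrow> nat \<Rightarrow> (nat \<Rightarrow> nat \<Rightarrow> enat) \<Rightarrow> (nat gword \<times> nat gword) set" where
  "shephard_relations n k p =
     {(replicate k (0, True), [])}
     \<union> {([(0, True), (i, True)], [(i, True), (0, True)]) | i. 2 \<le> i \<and> i \<le> n - 1}
     \<union> {(alt_word i j m, alt_word j i m) | i j m. 1 \<le> i \<and> i < j \<and> j \<le> n - 1 \<and> p i j = enat m}"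

definition shephard_group :: "nat \<Rightarrow> nat \<Rightarrow> (nat \<Rightarrow> nat \<Rightarrow> enat) \<Rightarrow> nat gword set monoid" where
  "shephard_group n k p = presented_group {0..n - 1} (shephard_relations n k p)"

definition shephard_gen :: "nat \<Rightarrow> nat \<Rightarrow> (nat \<Rightarrow> nat \<Rightarrow> enat) \<Rightarrow> nat \<Rightarrow> nat gword set" where
  "shephard_gen n k p i = pres_gen {0..n - 1} (shephard_relations n k p) i"

text \<open>For a set \<open>J\<close> of generating symbols, the subgroup generated by the \<open>a\<^sub>j\<close>, \<open>j \<in> J\<close>.
  Subsets of the generating set are taken as sets of symbols, so that intersections of them
  do not presuppose that distinct symbols have distinct images in the group.\<close>

definition shephard_subgroup :: "nat \<Rightarrow> nat \<Rightarrow> (nat \<Rightarrow> nat \<Rightarrow> enat) \<Rightarrow> nat set \<Rightarrow> nat gword set set" where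
  "shephard_subgroup n k p J = generate (shephard_group n k p) (shephard_gen n k p ` J)"

section \<open>Coset complexes\<close>

text \<open>An abstract simplicial complex is given by its vertex set and its set of simplices.
  The empty simplex is allowed.\<close>

definition simplicial_complex_on :: "'v set \<Rightarrow> 'v set set \<Rightarrow> bool" where
  "simplicial_complex_on V K \<longleftrightarrow>
     (\<forall>\<sigma>\<in>K. finite \<sigma> \<and> \<sigma> \<subseteq> V) \<and> (\<forall>v\<in>V. {v} \<in> K) \<and> (\<forall>\<sigma>\<in>K. \<forall>\<tau>. \<tau> \<subseteq> \<sigma> \<longrightarrow> \<tau> \<in> K)"

definition flag_complex :: "'v set \<Rightarrow> 'v set set \<Rightarrow> bool" where
  "flag_complex V K \<longleftrightarrow> simplicial_complex_on V K \<and>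
     (\<forall>\<sigma>. \<sigma> \<subseteq> V \<and> (\<forall>u\<in>\<sigma>. \<forall>v\<in>\<sigma>. u \<noteq> v \<longrightarrow> {u, v} \<in> K) \<longrightarrow> \<sigma> \<in> K)"

text \<open>A vertex is a coset tagged with its type, so that cosets of different types are different
  vertices even if they coincide as sets.\<close>

definition coset_vertices :: "('a, 'b) monoid_scheme \<Rightarrow> ('i \<Rightarrow> 'a set) \<Rightarrow> 'i set \<Rightarrow> ('i \<times> 'a set) set" where
  "coset_vertices G H I = {(i, g <#\<^bsub>G\<^esub> H i) | i g. i \<in> I \<and> g \<in> carrier G}"

definition coset_simplices :: "('a, 'b) monoid_scheme \<Rightarrow> ('i \<Rightarrow> 'a set) \<Rightarrow> 'i set \<Rightarrow> ('i \<times> 'a set) set set" where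
  "coset_simplices G H I =
     {\<sigma>. finite \<sigma> \<and> \<sigma> \<subseteq> coset_vertices G H I \<and> (\<Inter>v\<in>\<sigma>. snd v) \<noteq> {}}"

lemma coset_complex_simplicial:
  assumes "group G" "\<And>i. i \<in> I \<Longrightarrow> subgroup (H i) G"
  shows "simplicial_complex_on (coset_vertices G H I) (coset_simplices G H I)"
proof -
  have "g <#\<^bsub>G\<^esub> H i \<noteq> {}" if "i \<in> I" for g i
    using subgroup.one_closed[OF assms(2)[OF that]] by (auto simp: l_coset_def)
  then have "\<forall>v\<in>coset_vertices G H I. snd v \<noteq> {}"
    by (auto simp: coset_vertices_def)
  then have vert: "\<forall>v\<in>coset_vertices G H I. {v} \<in> coset_simplices G H I"
    by (simp add: coset_simplices_def)
  have face: "\<tau> \<in> coset_simplices G H I"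
    if \<sigma>: "\<sigma> \<in> coset_simplices G H I" and \<tau>: "\<tau> \<subseteq> \<sigma>" for \<sigma> \<tau>
  proof -
    from \<sigma> have fin: "finite \<sigma>" and sub: "\<sigma> \<subseteq> coset_vertices G H I"
      and "(\<Inter>v\<in>\<sigma>. snd v) \<noteq> {}"
      by (simp_all add: coset_simplices_def)
    then obtain x where "\<forall>v\<in>\<sigma>. x \<in> snd v" by auto
    with \<tau> have "x \<in> (\<Inter>v\<in>\<tau>. snd v)" by auto
    then have "(\<Inter>v\<in>\<tau>. snd v) \<noteq> {}" by (metis empty_iff)
    with finite_subset[OF \<tau> fin] subset_trans[OF \<tau> sub] show ?thesis
      by (simp add: coset_simplices_def)
  qed
  have "\<forall>\<sigma>\<in>coset_simplices G H I. finite \<sigma> \<and> \<sigma> \<subseteq> coset_vertices G H I"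
    by (simp add: coset_simplices_def)
  with vert face show ?thesis
    unfolding simplicial_complex_on_def by blast
qed

end

(*
Call a set-theoretic retraction of G onto <J> good if it is equivariant under left multiplication
by <J> and maps every <K> into <J \<inter> K>. Good retractions onto all <J> give everything: (a) is
immediate; for (b), if x = j y with x in <K> and y in <L>, then pi(x) = j pi(y) shows that j lies in
<J \<inter> K><J \<inter> L>; and (a) and (b) give the Helly property of cosets behind (c).

The retraction follows Charney and Paris. Let W be the quotient of G by the squares of a_1, a_2, ...
(a Dyer group: a_0 keeps its order k). Read a word letter by letter while walking in W, staying among
the elements d on the positive side of the walls of J: a letter x with d x d^-1 = j in J is
blocked and emits j, any other letter moves d to d x and emits nothing. The emitted word is the retraction.
That it respects the braid relations is a question about one coset d<s,t>. There one needs the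
parity of the number of crossings of a wall (Bourbaki's action of W on reflections with signs), a
shortest element of the coset, and the exact orders of the products s t in W. The latter come from
the numbers game, a form of the Tits representation.
*)

theory Submission
  imports Defs Complex_Main
begin

section \<open>Presented groups as groups of bijections\<close>

text \<open>The walk remembers only an element of W, while the emitted word has to be well defined
  in G, so each relation of G becomes a question about conjugacy in W. If both letters of a braid
  relation of length m are blocked, the two emitted words alternate in a pair j, j' that is
  conjugate in W to s, t. They are the two sides of a relation of G if that pair has braid length m
  as well; hence the product s t must determine \<open>p s t\<close> exactly. A letter a_0 must
  never emit a_j with j >= 1, since a_j^k need not be 1 in G; hence a_0 must not be conjugate to
  a_j. Finally, commuting letters a_0 and a_i must never emit a_0 and a_1, which satisfy no common
  relation in G; hence those two must not commute in W. The numbers game on weights settles the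
  first two points. For the last one it is too coarse, because a_0 acts trivially on weights, and a
  counter modulo k is attached to it.\<close>

text \<open>By Cayley's theorem the presented groups live in this type, whose class \<open>group_add\<close> spares
  the carrier conditions. The group is written additively but is not abelian.\<close>

typedef 'a bijection = "{f :: 'a \<Rightarrow> 'a. bij f}"
  by (auto intro: exI[of _ id])

instantiation bijection :: (type) group_add
begin

definition "0 = Abs_bijection id"
definition "f + g = Abs_bijection (Rep_bijection f \<circ> Rep_bijection g)"
definition "- f = Abs_bijection (inv_into UNIV (Rep_bijection f))"
definition "f - g = f + - (g :: 'a bijection)"

instance
proof
  have bij: "bij (Rep_bijection f)" for f :: "'a bijection"
    using Rep_bijection by auto
  fix f g h :: "'a bijection"
  show "f + g + h = f + (g + h)"
    using bij by (simp add: plus_bijection_def Abs_bijection_inverse bij_comp comp_assoc)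
  show "0 + f = f" "f + 0 = f"
    by (simp_all add: plus_bijection_def zero_bijection_def Abs_bijection_inverse Rep_bijection_inverse)
  show "- f + f = 0"
    using bij[of f]
    by (simp add: plus_bijection_def zero_bijection_def uminus_bijection_def Abs_bijection_inverse
        bij_imp_bij_inv bij_is_inj)
  show "f + - g = f - g"
    by (simp add: minus_bijection_def)
qed

end

lemmas group_add_simps = diff_conv_add_uminus add.assoc minus_add

lemma conj_eq_iff: "d + x - d = y \<longleftrightarrow> x = - d + y + d" for d x y :: "'w :: group_add"
  by (metis add.assoc add_diff_cancel add_minus_cancel diff_add_cancel minus_add_cancel)

lemma (in group) ex_faithful_bijection:
  "\<exists>\<phi> :: 'a \<Rightarrow> 'a bijection. inj_on \<phi> (carrier G) \<and>
     (\<forall>x\<in>carrier G. \<forall>y\<in>carrier G. \<phi> (x \<otimes> y) = \<phi> x + \<phi> y)"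
proof -
  \<comment> \<open>Left translation, extended by the identity outside the carrier so that it
    permutes the whole type.\<close>
  define L where "L x y = (if y \<in> carrier G then x \<otimes> y else y)" for x y
  have bij: "bij (L x)" if x: "x \<in> carrier G" for x
  proof (rule o_bij)
    show "L (inv x) \<circ> L x = id" "L x \<circ> L (inv x) = id"
      using x by (auto simp: L_def fun_eq_iff m_assoc[symmetric])
  qed
  define \<phi> where "\<phi> x = Abs_bijection (L x)" for x
  have "inj_on \<phi> (carrier G)"
  proof (rule inj_onI)
    fix x y assume xy: "x \<in> carrier G" "y \<in> carrier G" "\<phi> x = \<phi> y"
    then have "L x \<one> = L y \<one>"
      by (simp add: \<phi>_def Abs_bijection_inject bij)
    then show "x = y" using xy by (simp add: L_def)
  qed
  moreover have "\<phi> (x \<otimes> y) = \<phi> x + \<phi> y" if "x \<in> carrier G" "y \<in> carrier G" for x y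
  proof -
    have "L (x \<otimes> y) = L x \<circ> L y"
      using that by (auto simp: L_def fun_eq_iff m_assoc)
    then show ?thesis
      using that by (simp add: \<phi>_def plus_bijection_def Abs_bijection_inverse bij)
  qed
  ultimately show ?thesis by blast
qed

section \<open>Evaluation of words in a presented group\<close>

definition word_sum :: "('a \<Rightarrow> 'w::group_add) \<Rightarrow> 'a gword \<Rightarrow> 'w" where
  "word_sum r u = sum_list (map (\<lambda>(x, b). if b then r x else - r x) u)"

lemma word_sum_simps [simp]:
  "word_sum r [] = 0"
  "word_sum r ((x, True) # u) = r x + word_sum r u"
  "word_sum r ((x, False) # u) = - r x + word_sum r u"
  "word_sum r (u @ v) = word_sum r u + word_sum r v"
  by (simp_all add: word_sum_def)

lemma words_mono: "K \<subseteq> L \<Longrightarrow> u \<in> words K \<Longrightarrow> u \<in> words L"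
  by (auto simp: words_def)

lemma pres_class_eq_iff:
  "u \<in> words X \<Longrightarrow> v \<in> words X \<Longrightarrow>
    pres_rel X R `` {u} = pres_rel X R `` {v} \<longleftrightarrow> pres_eq X R u v"
  using eq_equiv_class_iff[OF equiv_pres_rel, of u X v R] by (simp add: pres_rel_def)

lemma generate_pres_gen:
  assumes "J \<subseteq> X"
  shows "generate (presented_group X R) (pres_gen X R ` J) = (\<lambda>u. pres_rel X R `` {u}) ` words J"
proof -
  let ?G = "presented_group X R" and ?c = "\<lambda>u. pres_rel X R `` {u}"
  interpret group ?G by (rule group_presented_group)
  have inv: "inv\<^bsub>?G\<^esub> pres_gen X R x = ?c [(x, False)]" if "x \<in> X" for x
  proof (rule inv_equality)
    show "?c [(x, False)] \<otimes>\<^bsub>?G\<^esub> pres_gen X R x = \<one>\<^bsub>?G\<^esub>"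
      using that pres_eq.cancel[OF that, of R False]
      by (simp add: pres_gen_def pres_mult_class pres_one pres_class_eq_iff)
    show "?c [(x, False)] \<in> carrier ?G"
      using that by (auto simp: pres_carrier)
  qed (rule pres_gen_closed[OF that])
  show ?thesis
  proof (intro equalityI subsetI)
    fix g assume "g \<in> generate ?G (pres_gen X R ` J)"
    then show "g \<in> ?c ` words J"
    proof (induction rule: generate.induct)
      case one
      then show ?case by (auto simp: pres_one)
    next
      case (incl h)
      then obtain x where "x \<in> J" "h = ?c [(x, True)]" by (auto simp: pres_gen_def)
      then show ?case by (intro image_eqI[of _ _ "[(x, True)]"]) auto
    next
      case (inv h)
      then obtain x where "x \<in> J" "h = pres_gen X R x" by auto
      then show ?case
        using \<open>\<And>x. x \<in> X \<Longrightarrow> inv\<^bsub>?G\<^esub> pres_gen X R x = ?c [(x, False)]\<close> assms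
        by (intro image_eqI[of _ _ "[(x, False)]"]) auto
    next
      case (eng g h)
      then obtain u v where "u \<in> words J" "v \<in> words J" "g = ?c u" "h = ?c v" by blast
      then show ?case
        using words_mono[OF assms] by (intro image_eqI[of _ _ "u @ v"]) (auto simp: pres_mult_class)
    qed
  next
    fix g assume "g \<in> ?c ` words J"
    then obtain u where "u \<in> words J" "g = ?c u" by blast
    moreover have "?c u \<in> generate ?G (pres_gen X R ` J)" if "u \<in> words J" for u
      using that
    proof (induction u)
      case Nil
      then show ?case using generate.one[of ?G] by (simp add: pres_one)
    next
      case (Cons y u)
      obtain x b where y: "y = (x, b)" by (cases y)
      have x: "x \<in> J" "x \<in> X" "u \<in> words J" "u \<in> words X"
        using Cons.prems y assms words_mono[OF assms] by auto
      have "?c [(x, b)] \<in> generate ?G (pres_gen X R ` J)"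
        using generate.incl[of "pres_gen X R x" _ ?G] generate.inv[of "pres_gen X R x" _ ?G] x inv[OF x(2)]
        by (cases b) (auto simp: pres_gen_def)
      from generate.eng[OF this Cons.IH[OF x(3)]] show ?case
        using x pres_mult_class[of "[(x, b)]" X u R] by (simp add: y)
    qed
    ultimately show "g \<in> generate ?G (pres_gen X R ` J)" by blast
  qed
qed

text \<open>Each generator goes to its left translation. Equality in the presented group then
  becomes equality of sums in a \<open>group_add\<close> type.\<close>

lemma ex_faithful_word_sum:
  "\<exists>r :: 'a \<Rightarrow> 'a gword set bijection.
     \<forall>u\<in>words X. \<forall>v\<in>words X. word_sum r u = word_sum r v \<longleftrightarrow> pres_eq X R u v"
proof -
  let ?G = "presented_group X R"
  interpret group ?G by (rule group_presented_group)
  obtain \<phi> :: "'a gword set \<Rightarrow> 'a gword set bijection" where inj: "inj_on \<phi> (carrier ?G)"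
    and hom: "\<And>x y. x \<in> carrier ?G \<Longrightarrow> y \<in> carrier ?G \<Longrightarrow> \<phi> (x \<otimes>\<^bsub>?G\<^esub> y) = \<phi> x + \<phi> y"
    using ex_faithful_bijection by blast
  have cl: "pres_rel X R `` {u} \<in> carrier ?G" if "u \<in> words X" for u
    using that by (auto simp: pres_carrier)
  have add: "\<phi> (pres_rel X R `` {u @ v}) = \<phi> (pres_rel X R `` {u}) + \<phi> (pres_rel X R `` {v})"
    if "u \<in> words X" "v \<in> words X" for u v
    using that hom[OF cl cl] by (simp add: pres_mult_class)
  have zero: "\<phi> (pres_rel X R `` {[]}) = 0"
    using add[of "[]" "[]"] by (metis add_0_right add_left_imp_eq append_Nil words_simps(1))
  define r where "r x = \<phi> (pres_rel X R `` {[(x, True)]})" for x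
  have inv: "\<phi> (pres_rel X R `` {[(x, False)]}) = - r x" if "x \<in> X" for x
  proof -
    have "pres_rel X R `` {[(x, False), (x, True)]} = pres_rel X R `` {[]}"
      using pres_eq.cancel[OF that, of R False] that by (simp add: pres_class_eq_iff)
    then have "\<phi> (pres_rel X R `` {[(x, False)]}) + r x = 0"
      using add[of "[(x, False)]" "[(x, True)]"] that zero by (simp add: r_def)
    then show ?thesis by (simp add: eq_neg_iff_add_eq_0)
  qed
  have sum: "word_sum r u = \<phi> (pres_rel X R `` {u})" if "u \<in> words X" for u
    using that
  proof (induction u)
    case Nil
    then show ?case by (simp add: zero)
  next
    case (Cons y u)
    obtain x b where y: "y = (x, b)" by (cases y)
    then show ?case
      using Cons add[of "[(x, b)]" u] inv[of x] by (cases b) (auto simp: r_def)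
  qed
  show ?thesis
    by (rule exI[of _ r]) (auto simp: sum inj_on_eq_iff[OF inj] cl pres_class_eq_iff)
qed

section \<open>Words acting on states\<close>

abbreviation run :: "('a \<Rightarrow> bool \<Rightarrow> 's \<Rightarrow> 's) \<Rightarrow> 'a gword \<Rightarrow> 's \<Rightarrow> 's" where
  "run act \<equiv> fold (\<lambda>(x, b). act x b)"

text \<open>A weak form of the universal property: the letters only need to act on an invariant set
  \<open>S\<close>, and no group of permutations has to be formed. Words are read from left to
  right, so this is a right action.\<close>

lemma pres_eq_run:
  assumes "pres_eq X R u v" and "s \<in> S"
    and closed: "\<And>x b s. x \<in> X \<Longrightarrow> s \<in> S \<Longrightarrow> act x b s \<in> S"
    and cancel: "\<And>x b s. x \<in> X \<Longrightarrow> s \<in> S \<Longrightarrow> act x (\<not> b) (act x b s) = s"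
    and rel: "\<And>l r s. (l, r) \<in> R \<Longrightarrow> s \<in> S \<Longrightarrow> run act l s = run act r s"
  shows "run act u s = run act v s"
proof -
  have run_closed: "run act u s \<in> S" if "u \<in> words X" "s \<in> S" for u s
    using that by (induction u arbitrary: s) (auto simp: closed)
  show ?thesis
    using assms(1,2)
  proof (induction arbitrary: s rule: pres_eq.induct)
    case (mult u u' v v')
    then show ?case using run_closed pres_eq_words by (metis comp_apply fold_append)
  qed (auto simp: cancel rel)
qed

section \<open>The numbers game\<close>

lemma alt_word_words [simp]: "s \<in> X \<Longrightarrow> t \<in> X \<Longrightarrow> alt_word s t q \<in> words X"
  by (induction s t q rule: alt_word.induct) auto

lemma alt_word_append:
  "alt_word a b (q + q') = alt_word a b q @ (if even q then alt_word a b q' else alt_word b a q')"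
  by (induction a b q rule: alt_word.induct) auto

lemma alt_word_prefix:
  "alt_word a b q = u @ (x, c) # v \<Longrightarrow>
    u = alt_word a b (length u) \<and> x = (if even (length u) then a else b) \<and> length u < q"
proof (induction a b q arbitrary: u rule: alt_word.induct)
  case (2 a b q)
  then show ?case by (cases u) auto
qed simp

text \<open>\<open>chebyshev c q\<close> is the Chebyshev polynomial of the second kind \<open>U\<^sub>q\<^sub>-\<^sub>1\<close> at \<open>c / 2\<close>.\<close>

fun chebyshev :: "real \<Rightarrow> nat \<Rightarrow> real" where
  "chebyshev c 0 = 0"
| "chebyshev c (Suc 0) = 1"
| "chebyshev c (Suc (Suc q)) = c * chebyshev c (Suc q) - chebyshev c q"

lemma chebyshev_sin: "chebyshev (2 * cos \<theta>) q * sin \<theta> = sin (q * \<theta>)"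
proof (induction q rule: induct_nat_012)
  case (ge2 q)
  have "sin ((real q + 2) * \<theta>) = 2 * cos \<theta> * sin ((real q + 1) * \<theta>) - sin (q * \<theta>)"
  proof -
    have e: "(real q + 2) * \<theta> = (real q + 1) * \<theta> + \<theta>" "q * \<theta> = (real q + 1) * \<theta> - \<theta>"
      by (simp_all add: algebra_simps)
    show ?thesis unfolding e by (simp add: sin_add sin_diff)
  qed
  with ge2 show ?case by (simp add: algebra_simps)
qed auto

lemma chebyshev_two: "chebyshev 2 q = real q"
  by (induction q rule: induct_nat_012) auto

text \<open>Minus twice the entry of the Tits form for a pair of braid length \<open>m\<close>. The
  value 2 at infinity is the limit of 2 cos (pi / m); there the Chebyshev values grow linearly and
  never return to 0.\<close>

definition braid_coeff :: "enat \<Rightarrow> real" where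
  "braid_coeff m = (case m of enat m \<Rightarrow> 2 * cos (pi / m) | \<infinity> \<Rightarrow> 2)"

lemma sin_pi_div_pos: "2 \<le> (m::nat) \<Longrightarrow> sin (pi / m) > 0"
  by (rule sin_gt_zero) (auto simp: field_simps)

lemma chebyshev_braid_coeff:
  assumes "2 \<le> m"
  shows "chebyshev (braid_coeff (enat m)) m = 0"
    and "chebyshev (braid_coeff (enat m)) (Suc m) = - 1"
    and "chebyshev (braid_coeff (enat m)) (m - 1) = 1"
proof -
  let ?c = "braid_coeff (enat m)" and ?\<theta> = "pi / m"
  have pos: "sin ?\<theta> > 0" using sin_pi_div_pos[OF assms] .
  have c: "chebyshev ?c q * sin ?\<theta> = sin (q * ?\<theta>)" for q
    by (simp add: braid_coeff_def chebyshev_sin)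
  show "chebyshev ?c m = 0"
    using c[of m] pos assms by simp
  have "Suc m * ?\<theta> = pi + ?\<theta>" using assms by (simp add: field_simps)
  then have "chebyshev ?c (Suc m) * sin ?\<theta> = (- 1) * sin ?\<theta>"
    using c[of "Suc m"] by (simp only:) (simp add: sin_add)
  then show "chebyshev ?c (Suc m) = - 1" using pos by (metis less_irrefl mult_right_cancel)
  have "real (m - 1) * ?\<theta> = pi - ?\<theta>" using assms by (simp add: field_simps of_nat_diff)
  then have "chebyshev ?c (m - 1) * sin ?\<theta> = 1 * sin ?\<theta>"
    using c[of "m - 1"] by (simp only:) (simp add: sin_diff)
  then show "chebyshev ?c (m - 1) = 1" using pos by (metis less_irrefl mult_right_cancel)
qed

lemma braid_coeff_bounds:
  assumes "2 \<le> m" shows "braid_coeff (enat m) < 2" "0 \<le> braid_coeff (enat m)"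
proof -
  have "cos (pi / m) < cos 0"
    using assms by (intro cos_monotone_0_pi) (auto simp: field_simps)
  then show "braid_coeff (enat m) < 2" by (simp add: braid_coeff_def)
  have "pi / m \<le> pi / 2" using assms by (intro divide_left_mono) auto
  moreover have "- (pi / 2) \<le> pi / m" by (rule order.trans[of _ 0]) auto
  ultimately have "0 \<le> cos (pi / m)" by (intro cos_ge_zero) auto
  then show "0 \<le> braid_coeff (enat m)" by (simp add: braid_coeff_def)
qed

lemma chebyshev_braid_coeff_zero:
  assumes "2 \<le> m" "chebyshev (braid_coeff m) q = 0" "0 < q"
  shows "\<exists>m'. m = enat m' \<and> m' dvd q"
proof (cases m)
  case (enat m')
  with assms have m': "2 \<le> m'" by (simp add: numeral_eq_enat)
  have "sin (q * (pi / m')) = 0"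
    using chebyshev_sin[of "pi / m'" q] assms(2) by (simp add: enat braid_coeff_def)
  then obtain i :: int where "q * (pi / m') = i * pi" by (auto simp: sin_zero_iff_int2)
  then have "real q = of_int i * real m'"
    using m' by (simp add: field_simps)
  then have "of_int (int q) = (of_int (i * int m') :: real)" by simp
  then have "int q = i * int m'" by (simp only: of_int_eq_iff)
  then have "int m' dvd int q" by simp
  then show ?thesis using enat by simp
next
  case infinity
  with assms show ?thesis by (simp add: braid_coeff_def chebyshev_two)
qed

text \<open>Firing \<open>s\<close> is the contragredient of the Tits reflection at \<open>s\<close>.\<close>

definition fire :: "(nat \<Rightarrow> nat \<Rightarrow> real) \<Rightarrow> nat \<Rightarrow> (nat \<Rightarrow> real) \<Rightarrow> nat \<Rightarrow> real" where
  "fire C s f = (\<lambda>u. f u + C s u * f s)"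

abbreviation fires :: "(nat \<Rightarrow> nat \<Rightarrow> real) \<Rightarrow> nat gword \<Rightarrow> (nat \<Rightarrow> real) \<Rightarrow> nat \<Rightarrow> real" where
  "fires C \<equiv> run (\<lambda>s _. fire C s)"

context
  fixes C :: "nat \<Rightarrow> nat \<Rightarrow> real" and s t :: nat and c :: real
  assumes C: "C s s = - 2" "C t t = - 2" "C s t = c" "C t s = c"
begin

text \<open>The value about to be fired obeys the three-term Chebyshev recursion. Firing it reverses
  its sign, which gives the second equation.\<close>

lemma fires_alt_coords:
  "fires C (alt_word s t q) f (if even q then s else t)
     = f s * chebyshev c (Suc q) + f t * chebyshev c q"
  "fires C (alt_word s t (Suc q)) f (if even q then s else t)
     = - (f s * chebyshev c (Suc q) + f t * chebyshev c q)"
proof -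
  have gen: "C a a = - 2 \<Longrightarrow> C b b = - 2 \<Longrightarrow> C a b = c \<Longrightarrow> C b a = c \<Longrightarrow>
     fires C (alt_word a b q) f (if even q then a else b)
       = f a * chebyshev c (Suc q) + f b * chebyshev c q" for a b q f
  proof (induction q arbitrary: a b f)
    case (Suc q)
    show ?case
      using Suc.IH[of b a "fire C a f"] Suc.prems
      by (auto simp: fire_def algebra_simps)
  qed simp
  show *: "fires C (alt_word s t q) f (if even q then s else t)
     = f s * chebyshev c (Suc q) + f t * chebyshev c q"
    by (rule gen[OF C])
  have "alt_word s t (Suc q) = alt_word s t q @ [(if even q then s else t, True)]"
    using alt_word_append[of s t q 1] by auto
  then show "fires C (alt_word s t (Suc q)) f (if even q then s else t)
     = - (f s * chebyshev c (Suc q) + f t * chebyshev c q)"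
    using * C by (auto simp: fire_def)
qed

lemma fires_span:
  "w \<in> words {s, t} \<Longrightarrow> \<exists>A B. fires C w f = (\<lambda>u. f u + A * C s u + B * C t u)"
proof (induction w arbitrary: f)
  case Nil
  then show ?case by (auto intro!: exI[of _ 0])
next
  case (Cons y w)
  obtain x b where y: "y = (x, b)" by (cases y)
  obtain A B where AB: "fires C w (fire C x f) = (\<lambda>u. fire C x f u + A * C s u + B * C t u)"
    using Cons.IH[of "fire C x f"] Cons.prems y by auto
  show ?case
  proof (cases "x = s")
    case True
    then show ?thesis unfolding y fold_Cons comp_apply prod.case AB
      by - (rule exI[of _ "A + f s"], rule exI[of _ B], auto simp: fire_def algebra_simps)
  next
    case False
    with Cons.prems y have "x = t" by auto
    then show ?thesis unfolding y fold_Cons comp_apply prod.case AB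
      by - (rule exI[of _ A], rule exI[of _ "B + f t"], auto simp: fire_def algebra_simps)
  qed
qed

end

text \<open>Both games change \<open>f\<close> by a combination of the rows of \<open>s\<close> and
  \<open>t\<close>. The Chebyshev values 1, 0, -1 around m make the coordinates at \<open>s\<close>
  and \<open>t\<close> agree, and the determinant 4 - c^2 is positive, so the combinations agree
  too.\<close>

lemma fires_braid:
  assumes C: "C s s = - 2" "C t t = - 2" "C s t = braid_coeff (enat m)" "C t s = braid_coeff (enat m)"
    and m: "2 \<le> m"
  shows "fires C (alt_word s t m) f = fires C (alt_word t s m) f"
proof -
  let ?c = "braid_coeff (enat m)"
  note C' = C(2,1,4,3)
  obtain m' where m': "m = Suc m'" using m by (cases m) auto
  note ch = chebyshev_braid_coeff[OF m]
  have ch': "chebyshev ?c (Suc m') = 0" "chebyshev ?c m' = 1" "chebyshev ?c (Suc (Suc m')) = - 1"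
    using ch m' by auto
  define F where "F = fires C (alt_word s t m) f"
  define F' where "F' = fires C (alt_word t s m) f"
  have co: "F s = F' s" "F t = F' t"
    unfolding F_def F'_def
    using fires_alt_coords[OF C, of m f] fires_alt_coords(2)[OF C, of m' f]
      fires_alt_coords[OF C', of m f] fires_alt_coords(2)[OF C', of m' f] ch' m'
    by (auto split: if_splits)
  obtain A B where F: "F = (\<lambda>u. f u + A * C s u + B * C t u)"
    using fires_span[OF C, of "alt_word s t m" f] by (auto simp: F_def)
  obtain A' B' where F': "F' = (\<lambda>u. f u + A' * C s u + B' * C t u)"
    using fires_span[OF C, of "alt_word t s m" f] by (auto simp: F'_def)
  have "- 2 * (A - A') + ?c * (B - B') = 0" "?c * (A - A') - 2 * (B - B') = 0"
    using co F F' C by (auto simp: algebra_simps)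
  moreover from this have "(4 - ?c * ?c) * (A - A') = 0"
    by algebra
  moreover have "?c * ?c < 2 * 2"
    using braid_coeff_bounds[OF m] by (intro mult_strict_mono') auto
  ultimately have "A = A'" "B = B'" by auto
  then show ?thesis using F F' by (simp add: F_def F'_def)
qed

lemma fires_braid_imp_dvd:
  assumes C: "C s s = - 2" "C t t = - 2" "C s t = braid_coeff m" "C t s = braid_coeff m"
    and m: "2 \<le> m" and "s \<noteq> t" and q: "0 < q"
    and eq: "\<And>f. fires C (alt_word s t q) f = fires C (alt_word t s q) f"
  shows "\<exists>m'. m = enat m' \<and> m' dvd q"
proof (rule chebyshev_braid_coeff_zero[OF m _ q])
  note C' = C(2,1,4,3)
  obtain q' where q': "q = Suc q'" using q by (cases q) auto
  \<comment> \<open>Started from this unit vector, the two games end at coordinate \<open>s\<close>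
    with opposite values, plus and minus \<open>chebyshev (braid_coeff m) q\<close>; so equality
    forces it to vanish.\<close>
  let ?f = "\<lambda>u. if u = (if even q then t else s) then 1 else 0 :: real"
  show "chebyshev (braid_coeff m) q = 0"
    using fires_alt_coords[OF C, of q ?f] fires_alt_coords(2)[OF C, of q' ?f]
      fires_alt_coords[OF C', of q ?f] fires_alt_coords(2)[OF C', of q' ?f] q' \<open>s \<noteq> t\<close>
      eq[of ?f]
    by (auto split: if_splits)
qed

section \<open>The Dyer quotient\<close>

definition dyer_relations :: "nat \<Rightarrow> nat \<Rightarrow> (nat \<Rightarrow> nat \<Rightarrow> enat) \<Rightarrow> (nat gword \<times> nat gword) set" where
  "dyer_relations n k p =
     shephard_relations n k p \<union> {([(i, True), (i, True)], []) | i. 1 \<le> i \<and> i \<le> n - 1}"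

text \<open>\<open>r\<close> realizes W, not the Shephard group. The latter enters only as the
  congruence of words under \<open>shephard_relations\<close>.\<close>

locale shephard =
  fixes n k :: nat and p :: "nat \<Rightarrow> nat \<Rightarrow> enat" and r :: "nat \<Rightarrow> 'w :: group_add"
  assumes n: "2 \<le> n" and k: "2 \<le> k"
    and p: "\<And>i j. 1 \<le> i \<Longrightarrow> i < j \<Longrightarrow> j \<le> n - 1 \<Longrightarrow> p i j = p j i \<and> 2 \<le> p i j"
    and word_sum_eq_iff: "\<And>u v. u \<in> words {0..n - 1} \<Longrightarrow> v \<in> words {0..n - 1} \<Longrightarrow>
      word_sum r u = word_sum r v \<longleftrightarrow> pres_eq {0..n - 1} (dyer_relations n k p) u v"
begin

abbreviation "X \<equiv> {0..n - 1}"
abbreviation "ev \<equiv> word_sum r"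
abbreviation "W \<equiv> ev ` words X"

lemma p_sym: "1 \<le> i \<Longrightarrow> 1 \<le> j \<Longrightarrow> i \<in> X \<Longrightarrow> j \<in> X \<Longrightarrow> i \<noteq> j \<Longrightarrow> p i j = p j i \<and> 2 \<le> p i j"
  using p[of i j] p[of j i] by (cases "i < j") auto

section \<open>The numbers game as a representation of W\<close>

definition coeff :: "nat \<Rightarrow> nat \<Rightarrow> real" where
  "coeff i j = (if i = j then - 2 else braid_coeff (p i j))"

definition weight :: "nat \<Rightarrow> nat \<Rightarrow> real" where
  "weight i = (\<lambda>u. if u = i then 1 else 0)"

text \<open>The numbers game is extended to \<open>a\<^sub>0\<close> by a counter modulo \<open>k\<close> that only runs at the
  first fundamental weight. This weight is fixed by \<open>a\<^sub>2, a\<^sub>3, \<dots>\<close> but not by \<open>a\<^sub>1\<close>.\<close>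

fun rep :: "nat \<Rightarrow> bool \<Rightarrow> (nat \<Rightarrow> real) \<times> nat \<Rightarrow> (nat \<Rightarrow> real) \<times> nat" where
  "rep x b (f, e) =
     (if x = 0 then (f, if f = weight 1 then (if b then e + 1 else e + (k - 1)) mod k else e)
      else (fire coeff x f, e))"

lemma fire_fire [simp]: "fire coeff x (fire coeff x f) = f"
  by (auto simp: fire_def coeff_def)

lemma fire_weight: "x \<noteq> i \<Longrightarrow> fire coeff x (weight i) = weight i"
  by (auto simp: fire_def weight_def)

lemma fire_weight_self: "fire coeff x (weight x) \<noteq> weight x"
  by (auto simp: fire_def weight_def coeff_def fun_eq_iff)

lemma fire_eq_weight: "x \<noteq> i \<Longrightarrow> fire coeff x f = weight i \<longleftrightarrow> f = weight i"
  using fire_fire fire_weight by metis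

lemma run_rep_alt_word:
  "1 \<le> i \<Longrightarrow> 1 \<le> j \<Longrightarrow> run rep (alt_word i j q) (f, e) = (fires coeff (alt_word i j q) f, e)"
  by (induction i j q arbitrary: f rule: alt_word.induct) auto

lemma run_rep_power:
  "e < k \<Longrightarrow> run rep (replicate q (0, True)) (f, e) = (f, if f = weight 1 then (e + q) mod k else e)"
  by (induction q arbitrary: e) (auto simp: mod_simps)

lemma coeff_braid:
  assumes "1 \<le> i" "1 \<le> j" "i \<in> X" "j \<in> X" "i \<noteq> j"
  shows "coeff i i = - 2" "coeff j j = - 2" "coeff i j = braid_coeff (p i j)" "coeff j i = braid_coeff (p i j)"
  using assms p_sym by (auto simp: coeff_def)

text \<open>In the relation of a_0 with a_i, i >= 2, firing \<open>i\<close> neither reaches nor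
  leaves the first weight, so the counter runs alike in both orders.\<close>

lemma run_rep_eq:
  assumes "u \<in> words X" "v \<in> words X" "ev u = ev v" "e < k"
  shows "run rep u (f, e) = run rep v (f, e)"
proof (rule pres_eq_run[where S = "{s. snd s < k}"])
  show "pres_eq X (dyer_relations n k p) u v"
    using assms word_sum_eq_iff by blast
  show "rep x b s \<in> {s. snd s < k}" if "x \<in> X" "s \<in> {s. snd s < k}" for x b s
    using that k by (cases s) auto
  show "rep x (\<not> b) (rep x b s) = s" if "x \<in> X" "s \<in> {s. snd s < k}" for x b s
  proof -
    have "(Suc e mod k + (k - 1)) mod k = e" "Suc ((e + (k - 1)) mod k) mod k = e" if "e < k" for e
      using that by (cases "Suc e = k", auto simp: mod_simps)+
    then show ?thesis using that k by (cases s) auto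
  qed
  show "run rep l s = run rep r' s" if lr: "(l, r') \<in> dyer_relations n k p" and e: "s \<in> {s. snd s < k}" for l r' s
  proof -
    obtain f e where s: "s = (f, e)" "e < k" using e by (cases s) auto
    from lr consider
        "l = replicate k (0, True)" "r' = []"
      | i where "l = [(0, True), (i, True)]" "r' = [(i, True), (0, True)]" "2 \<le> i"
      | i j m where "l = alt_word i j m" "r' = alt_word j i m" "1 \<le> i" "i < j" "j \<le> n - 1" "p i j = enat m"
      | i where "l = [(i, True), (i, True)]" "r' = []" "1 \<le> i"
      unfolding dyer_relations_def shephard_relations_def by blast
    then show ?thesis
    proof cases
      case 1
      then show ?thesis using s run_rep_power[of e k f] by simp
    next
      case (2 i)
      then show ?thesis using s by (auto simp: fire_eq_weight)
    next
      case (3 i j m)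
      then have "2 \<le> m" using p[of i j] by (metis enat_ord_simps(1) numeral_eq_enat)
      then show ?thesis
        using 3 s fires_braid[of coeff i j m f] coeff_braid[of i j]
        by (simp add: run_rep_alt_word)
    next
      case (4 i)
      then show ?thesis using s by auto
    qed
  qed
qed (use assms in auto)

text \<open>The fundamental weight at \<open>j\<close> separates: every other letter fixes it, while
  firing \<open>j\<close> moves it.\<close>

lemma gen_in_parabolic_imp:
  assumes "r j \<in> ev ` words K" "1 \<le> j" "j \<in> X" "K \<subseteq> X"
  shows "j \<in> K"
proof (rule ccontr)
  assume "j \<notin> K"
  obtain u where u: "u \<in> words K" "r j = ev u" using assms(1) by blast
  have fix_weight: "fst (run rep u (weight j, e)) = weight j" for e
    using u(1)
  proof (induction u arbitrary: e)
    case (Cons y u)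
    moreover have "fst y \<noteq> j" using Cons.prems \<open>j \<notin> K\<close> by (cases y) auto
    ultimately show ?case by (cases y) (auto simp: fire_weight)
  qed simp
  have "u \<in> words X" using u(1) assms(4) by (auto simp: words_def)
  then have "run rep u (weight j, 0) = run rep [(j, True)] (weight j, 0)"
    using u(2) assms(3) k by (intro run_rep_eq) auto
  then show False
    using fix_weight[of 0] assms(2) fire_weight_self[of j] by auto
qed

lemma gen_inj: "i \<in> X \<Longrightarrow> j \<in> X \<Longrightarrow> r i = r j \<Longrightarrow> i = j"
proof -
  have *: "i = j" if "i \<in> X" "j \<in> X" "r i = r j" "1 \<le> j" for i j
    using gen_in_parabolic_imp[of j "{i}"] that
    by (metis (no_types, lifting) add_0_right empty_subsetI image_eqI insert_subset singletonD singletonI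
        word_sum_simps(1,2) words_simps(1,2))
  show "i \<in> X \<Longrightarrow> j \<in> X \<Longrightarrow> r i = r j \<Longrightarrow> i = j"
    using *[of i j] *[of j i] by (cases "i = 0"; cases "j = 0") auto
qed

text \<open>On weights a_0 acts trivially, hence so do its conjugates, whereas firing
  \<open>j\<close> does not.\<close>

lemma gen0_not_conj:
  assumes d: "d \<in> W" and j: "1 \<le> j" "j \<in> X"
  shows "d + r 0 - d \<noteq> r j"
proof
  assume "d + r 0 - d = r j"
  then have eq: "d + r 0 = r j + d" by (simp add: diff_eq_eq)
  obtain u where u: "u \<in> words X" "d = ev u" using d by blast
  have "run rep (u @ [(0, True)]) (weight j, 0) = run rep ((j, True) # u) (weight j, 0)"
    using u j k eq by (intro run_rep_eq) auto
  then have "rep 0 True (run rep u (weight j, 0)) = run rep u (fire coeff j (weight j), 0)"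
    using j by (simp del: rep.simps) simp
  moreover have "fst (rep 0 b s) = fst s" for b s
    by (cases s) auto
  ultimately have *: "fst (run rep u (weight j, 0)) = fst (run rep u (fire coeff j (weight j), 0))"
    by metis
  have inj: "f = g" if "fst (run rep u (f, e)) = fst (run rep u (g, e'))" for f g e e'
    using that
  proof (induction u arbitrary: f g e e')
    case (Cons y u)
    obtain x b where y: "y = (x, b)" by (cases y)
    show ?case
    proof (cases "x = 0")
      case True
      then obtain c c' where "rep x b (f, e) = (f, c)" "rep x b (g, e') = (g, c')" by auto
      then show ?thesis using Cons.prems Cons.IH[of f c g c'] by (simp add: y)
    next
      case False
      then have "fire coeff x f = fire coeff x g"
        using Cons.prems Cons.IH[of "fire coeff x f" e "fire coeff x g" e'] by (simp add: y)
      then show ?thesis using fire_fire by metis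
    qed
  qed simp
  from inj[OF *] fire_weight_self show False by metis
qed

text \<open>Started at the first weight, a_0 advances the counter if read before a_1, but not after
  a_1 has moved the weight away. One tick is visible because k >= 2.\<close>

lemma gen0_gen1_not_commute: "r 0 + r 1 \<noteq> r 1 + r 0"
proof
  assume "r 0 + r 1 = r 1 + r 0"
  then have "ev [(0, True), (1, True)] = ev [(1, True), (0, True)]"
    by (simp only: word_sum_simps add_0_right)
  from run_rep_eq[OF _ _ this, of 0 "weight 1"]
  have "run rep [(0, True), (1, True)] (weight 1, 0) = run rep [(1, True), (0, True)] (weight 1, 0)"
    using n k by auto
  then have "Suc 0 mod k = (0 :: nat)"
    using fire_weight_self[of 1] by (simp split: if_splits)
  then show False using k by simp
qed

lemma braid_imp_dvd:
  assumes ij: "1 \<le> i" "1 \<le> j" "i \<in> X" "j \<in> X" "i \<noteq> j" and "0 < q"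
    and "ev (alt_word i j q) = ev (alt_word j i q)"
  shows "\<exists>m. p i j = enat m \<and> m dvd q"
proof (rule fires_braid_imp_dvd[where C = coeff])
  show "fires coeff (alt_word i j q) f = fires coeff (alt_word j i q) f" for f
    using run_rep_eq[of "alt_word i j q" "alt_word j i q" 0 f] assms k
    by (simp add: run_rep_alt_word)
  show "2 \<le> p i j" using p_sym ij by blast
qed (rule coeff_braid ij \<open>0 < q\<close>)+

lemma ev_rel: "(u, v) \<in> dyer_relations n k p \<Longrightarrow> u \<in> words X \<Longrightarrow> v \<in> words X \<Longrightarrow> ev u = ev v"
  using word_sum_eq_iff pres_eq.rel by blast

lemma involution: "1 \<le> i \<Longrightarrow> i \<in> X \<Longrightarrow> r i + r i = 0"
  using ev_rel[of "[(i, True), (i, True)]" "[]"] by (auto simp: dyer_relations_def)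

lemma uminus_gen: "1 \<le> i \<Longrightarrow> i \<in> X \<Longrightarrow> - r i = r i"
  using involution by (metis minus_unique)

lemma gen0_commute: "2 \<le> i \<Longrightarrow> i \<in> X \<Longrightarrow> r 0 + r i = r i + r 0"
  using ev_rel[of "[(0, True), (i, True)]" "[(i, True), (0, True)]"]
  by (auto simp: dyer_relations_def shephard_relations_def)

lemma braid:
  assumes "1 \<le> i" "1 \<le> j" "i \<in> X" "j \<in> X" "i \<noteq> j" "p i j = enat m"
  shows "ev (alt_word i j m) = ev (alt_word j i m)"
proof (cases "i < j")
  case True
  then have "(alt_word i j m, alt_word j i m) \<in> dyer_relations n k p"
    using assms unfolding dyer_relations_def shephard_relations_def by auto
  then show ?thesis using assms by (intro ev_rel) auto
next
  case False
  then have "(alt_word j i m, alt_word i j m) \<in> dyer_relations n k p"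
    using assms p_sym[of i j] unfolding dyer_relations_def shephard_relations_def by auto
  then show ?thesis using assms by (intro ev_rel[symmetric]) auto
qed

lemma W_closed [simp, intro]:
  "0 \<in> W"
  "x \<in> X \<Longrightarrow> r x \<in> W"
  "x \<in> X \<Longrightarrow> - r x \<in> W"
  "d \<in> W \<Longrightarrow> d' \<in> W \<Longrightarrow> d + d' \<in> W"
proof -
  show "0 \<in> W" by (rule image_eqI[of _ _ "[]"]) auto
  show "r x \<in> W" if "x \<in> X" using that by (intro image_eqI[of _ _ "[(x, True)]"]) auto
  show "- r x \<in> W" if "x \<in> X" using that by (intro image_eqI[of _ _ "[(x, False)]"]) auto
  show "d + d' \<in> W" if dd: "d \<in> W" "d' \<in> W"
  proof -
    obtain u v where "u \<in> words X" "v \<in> words X" "d = ev u" "d' = ev v" using dd by blast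
    then show ?thesis by (intro image_eqI[of _ _ "u @ v"]) auto
  qed
qed

subsection \<open>Walls\<close>

text \<open>The walls crossed by a gallery in the Cayley graph of \<open>W\<close>, each wall being represented
  by a conjugate of a generator. The generator \<open>a\<^sub>0\<close> of order \<open>k\<close> is left out.\<close>

fun walls :: "'w \<Rightarrow> nat gword \<Rightarrow> 'w list" where
  "walls d [] = []"
| "walls d ((x, b) # u) =
     (if x = 0 then [] else [d + r x - d]) @ walls (d + (if b then r x else - r x)) u"

lemma walls_append: "walls d (u @ v) = walls d u @ walls (d + ev u) v"
  by (induction d u rule: walls.induct) (auto simp: add.assoc)

lemma walls_shift: "walls (c + d) u = map (\<lambda>t. c + t - c) (walls d u)"
  by (induction d u rule: walls.induct) (auto simp: group_add_simps simp del: add_uminus_conv_diff)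

lemma count_walls_shift: "count_list (walls d u) t = count_list (walls 0 u) (- d + t + d)"
proof -
  have "count_list (map (\<lambda>t. d + t - d) ts) t = count_list ts (- d + t + d)" for ts
  proof (induction ts)
    case (Cons a ts)
    have "d + a - d = t \<longleftrightarrow> a = - d + t + d"
      by (metis add.assoc add_diff_cancel add_minus_cancel diff_add_cancel minus_add_cancel)
    then show ?case using Cons by auto
  qed simp
  then show ?thesis using walls_shift[of d 0 u] by simp
qed

lemma walls_replicate0 [simp]: "walls d (replicate q (0, True)) = []"
  by (induction q arbitrary: d) auto

lemma mem_walls:
  "t \<in> set (walls d u) \<Longrightarrow> \<exists>u\<^sub>1 x b u\<^sub>2. u = u\<^sub>1 @ (x, b) # u\<^sub>2 \<and> x \<noteq> 0 \<and> t = d + ev u\<^sub>1 + r x - (d + ev u\<^sub>1)"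
proof (induction d u rule: walls.induct)
  case (2 d x b u)
  show ?case
  proof (cases "t \<in> set (walls (d + (if b then r x else - r x)) u)")
    case True
    from 2(1)[OF True] obtain u\<^sub>1 x' b' u\<^sub>2 where
      "u = u\<^sub>1 @ (x', b') # u\<^sub>2" "x' \<noteq> 0"
      "t = d + (if b then r x else - r x) + ev u\<^sub>1 + r x' - (d + (if b then r x else - r x) + ev u\<^sub>1)"
      by blast
    then show ?thesis
      by (intro exI[of _ "(x, b) # u\<^sub>1"] exI[of _ x'] exI[of _ b'] exI[of _ u\<^sub>2]) (auto simp: add.assoc)
  next
    case False
    then have "x \<noteq> 0" "t = d + r x - d" using 2(2) by (auto split: if_splits)
    then show ?thesis
      by (intro exI[of _ "[]"] exI[of _ x] exI[of _ b] exI[of _ u]) auto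
  qed
qed simp

lemma alt_uminus:
  assumes "1 \<le> a" "1 \<le> b" "a \<in> X" "b \<in> X"
  shows "- ev (alt_word a b q) = (if even q then ev (alt_word b a q) else ev (alt_word a b q))"
  using assms
proof (induction a b q rule: alt_word.induct)
  case (2 a b q)
  have "- ev (alt_word a b (Suc q)) = - ev (alt_word b a q) + r a"
    using 2 uminus_gen[of a] by (simp add: minus_add)
  also have "\<dots> = (if even q then ev (alt_word a b q) else ev (alt_word b a q)) + r a"
    using 2 by auto
  also have "\<dots> = (if even (Suc q) then ev (alt_word b a (Suc q)) else ev (alt_word a b (Suc q)))"
    using alt_word_append[of a b q 1] alt_word_append[of b a q 1]
    by (simp del: alt_word.simps(2)) (simp add: numeral_eq_Suc)
  finally show ?case .
qed simp

text \<open>The walls met by an alternating gallery are themselves alternating words of odd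
  length.\<close>

lemma alt_conj:
  assumes "1 \<le> a" "1 \<le> b" "a \<in> X" "b \<in> X"
  shows "ev (alt_word a b q) + r (if even q then a else b) - ev (alt_word a b q)
    = ev (alt_word a b (Suc (2 * q)))"
  using assms
proof (induction a b q rule: alt_word.induct)
  case (2 a b q)
  have "ev (alt_word a b (Suc q)) + r (if even (Suc q) then a else b) - ev (alt_word a b (Suc q))
    = r a + (ev (alt_word b a q) + r (if even q then b else a) - ev (alt_word b a q)) + r a"
    using 2(2-5) uminus_gen[of a] by (simp add: group_add_simps del: add_uminus_conv_diff)
  also have "\<dots> = r a + ev (alt_word b a (Suc (2 * q))) + r a"
    by (simp only: 2)
  also have "\<dots> = ev (alt_word a b (Suc (Suc (2 * q)) + 1))"
    by (subst alt_word_append) (simp add: add.assoc)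
  finally show ?case by simp
qed simp

lemma alt_double_eq_0:
  assumes "1 \<le> a" "1 \<le> b" "a \<in> X" "b \<in> X" and "ev (alt_word a b (2 * q)) = 0"
  shows "ev (alt_word a b q) = ev (alt_word b a q)"
proof -
  have "ev (alt_word a b q) + (if even q then ev (alt_word a b q) else ev (alt_word b a q)) = 0"
    using assms(5) alt_word_append[of a b q q] by (simp add: mult_2 split: if_splits)
  then have "ev (alt_word a b q) - ev (alt_word b a q) = 0"
    using alt_uminus[of b a q] assms(1-4) by (simp only: diff_conv_add_uminus split: if_splits)
  then show ?thesis by simp
qed

text \<open>The alternating word of length 2m is trivial, so the odd words of lengths l and 2m - l,
  one starting with \<open>a\<close> and the other with \<open>b\<close>, coincide. Hence the two
  sides of the braid relation meet the same walls in opposite order.\<close>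

lemma count_walls_alt:
  assumes ab: "1 \<le> a" "1 \<le> b" "a \<in> X" "b \<in> X" and braid: "ev (alt_word a b m) = ev (alt_word b a m)"
  shows "count_list (walls 0 (alt_word a b m)) t = count_list (walls 0 (alt_word b a m)) t"
proof -
  have walls: "walls 0 (alt_word a b q) = map (\<lambda>i. ev (alt_word a b (Suc (2 * i)))) [0..<q]"
    if ab: "1 \<le> a" "1 \<le> b" "a \<in> X" "b \<in> X" for a b q
  proof (induction q)
    case (Suc q)
    have "alt_word a b (Suc q) = alt_word a b q @ [(if even q then a else b, True)]"
      using alt_word_append[of a b q 1] by auto
    then have "walls 0 (alt_word a b (Suc q)) = walls 0 (alt_word a b q) @ [ev (alt_word a b (Suc (2 * q)))]"
      using alt_conj[OF ab, of q] ab by (simp add: walls_append del: alt_word.simps(2))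
    then show ?case using Suc by simp
  qed simp
  have pair: "ev (alt_word a b (Suc (2 * i))) = ev (alt_word b a (Suc (2 * (m - Suc i))))" if "i < m" for i
  proof -
    let ?l = "Suc (2 * i)" and ?l' = "Suc (2 * (m - Suc i))"
    have "m + m = ?l + ?l'" using that by simp
    then have "ev (alt_word a b ?l) + ev (alt_word b a ?l') = ev (alt_word a b (m + m))"
      by (simp only: alt_word_append[of a b ?l ?l']) (simp add: add.assoc)
    also have "\<dots> = ev (alt_word a b m) + (if even m then ev (alt_word a b m) else ev (alt_word b a m))"
      by (simp add: alt_word_append)
    also have "\<dots> = ev (alt_word a b m) - ev (alt_word b a m)"
      using alt_uminus[of b a m] ab by (simp only: diff_conv_add_uminus split: if_splits)
    finally have "ev (alt_word a b ?l) = - ev (alt_word b a ?l')"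
      using braid by (metis diff_self eq_neg_iff_add_eq_0)
    then show ?thesis using alt_uminus[of b a ?l'] ab by (simp del: alt_word.simps(2))
  qed
  have "walls 0 (alt_word a b m) = rev (walls 0 (alt_word b a m))"
    unfolding walls[OF ab] walls[OF ab(2,1,4,3)]
    by (rule nth_equalityI) (auto simp: rev_nth pair simp del: alt_word.simps(2))
  then show ?thesis by simp
qed

text \<open>Only the parity survives, since cancelling a letter other than a_0 removes two crossings
  of one wall. In the commutation relation, a_0 leaves the wall of a_i in place.\<close>

lemma odd_count_walls_eq:
  assumes "u \<in> words X" "v \<in> words X" "ev u = ev v"
  shows "odd (count_list (walls d u) t) \<longleftrightarrow> odd (count_list (walls d v) t)"
proof -
  have "pres_eq X (dyer_relations n k p) u v"
    using assms word_sum_eq_iff by blast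
  then show ?thesis
  proof (induction arbitrary: d t rule: pres_eq.induct)
    case (cancel x b)
    then show ?case by (cases b) (auto simp: group_add_simps simp del: add_uminus_conv_diff)
  next
    case (rel l r')
    from rel(1) consider
        "l = replicate k (0, True)" "r' = []"
      | i where "l = [(0, True), (i, True)]" "r' = [(i, True), (0, True)]" "2 \<le> i" "i \<le> n - 1"
      | i j m where "l = alt_word i j m" "r' = alt_word j i m" "1 \<le> i" "i < j" "j \<le> n - 1" "p i j = enat m"
      | i where "l = [(i, True), (i, True)]" "r' = []" "1 \<le> i" "i \<le> n - 1"
      unfolding dyer_relations_def shephard_relations_def by blast
    then show ?case
    proof cases
      case (2 i)
      then have "r 0 + r i = r i + r 0" using gen0_commute by auto
      then have "r 0 + (r i - r 0) = r i"
        by (metis add.assoc add_diff_cancel diff_conv_add_uminus)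
      then have "d + r 0 + r i - (d + r 0) = d + r i - d"
        by (simp add: group_add_simps del: add_uminus_conv_diff) (metis add.assoc)
      then show ?thesis using 2 by simp
    next
      case (3 i j m)
      have ij: "1 \<le> i" "1 \<le> j" "i \<in> X" "j \<in> X" "i \<noteq> j" using 3 by auto
      show ?thesis
        unfolding 3(1,2) count_walls_shift[of d]
        by (simp only: count_walls_alt[OF ij(1-4) braid[OF ij 3(6)]])
    next
      case (4 i)
      then show ?thesis by (auto simp: group_add_simps simp del: add_uminus_conv_diff)
    qed simp
  next
    case (mult u u' v v')
    then have "ev u = ev u'" using pres_eq_words word_sum_eq_iff by blast
    then show ?case using mult.IH by (simp add: walls_append)
  qed auto
qed

text \<open>The wall \<open>t\<close> separates 0 from \<open>d\<close>. By
  \<open>odd_count_walls_eq\<close> any word for \<open>d\<close> decides this.\<close>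

definition crosses :: "'w \<Rightarrow> 'w \<Rightarrow> bool" where
  "crosses d t \<longleftrightarrow> (\<exists>u\<in>words X. ev u = d \<and> odd (count_list (walls 0 u) t))"

lemma crosses_ev: "u \<in> words X \<Longrightarrow> crosses (ev u) t \<longleftrightarrow> odd (count_list (walls 0 u) t)"
  unfolding crosses_def using odd_count_walls_eq by blast

lemma crosses_0 [simp]: "\<not> crosses 0 t"
  using crosses_ev[of "[]" t] by simp

lemma crosses_gen:
  assumes "x \<in> X"
  shows "crosses (r x) t \<longleftrightarrow> x \<noteq> 0 \<and> t = r x" "crosses (- r x) t \<longleftrightarrow> x \<noteq> 0 \<and> t = r x"
  using crosses_ev[of "[(x, True)]" t] crosses_ev[of "[(x, False)]" t] assms by auto

lemma crosses_add:
  assumes "d \<in> W" "d' \<in> W"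
  shows "crosses (d + d') t \<longleftrightarrow> crosses d t \<noteq> crosses d' (- d + t + d)"
proof -
  obtain u v where uv: "u \<in> words X" "v \<in> words X" "d = ev u" "d' = ev v" using assms by blast
  then show ?thesis
    using crosses_ev[of "u @ v" t]
    by (auto simp: crosses_ev walls_append count_walls_shift[of "ev u"])
qed

text \<open>The source of the exchange argument: an odd count is positive, so some letter of the
  word meets the wall.\<close>

lemma crosses_imp_prefix:
  assumes "u \<in> words X" "crosses (ev u) t"
  shows "\<exists>u\<^sub>1 x b u\<^sub>2. u = u\<^sub>1 @ (x, b) # u\<^sub>2 \<and> x \<noteq> 0 \<and> t = ev u\<^sub>1 + r x - ev u\<^sub>1"
proof -
  have "t \<in> set (walls 0 u)"
    using assms crosses_ev by (metis count_list_0_iff even_zero)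
  from mem_walls[OF this] show ?thesis by simp
qed

subsection \<open>Dihedral cosets\<close>

lemma uminus_in_parabolic:
  "v \<in> words K \<Longrightarrow> \<exists>v'\<in>words K. ev v' = - ev v"
proof (induction v)
  case (Cons y v)
  obtain x b where y: "y = (x, b)" by (cases y)
  with Cons obtain v' where "v' \<in> words K" "ev v' = - ev v" "x \<in> K" by auto
  then show ?case
    by (intro bexI[of _ "v' @ [(x, \<not> b)]"]) (cases b; simp add: y minus_add)+
qed (auto intro!: bexI[of _ "[]"])

lemma W_uminus:
  assumes "d \<in> W" shows "- d \<in> W"
proof -
  obtain u where "u \<in> words X" "d = ev u" using assms by blast
  then obtain v where "v \<in> words X" "ev v = - d" using uminus_in_parabolic by blast
  then show ?thesis by (intro image_eqI[of _ _ v]) auto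
qed

lemma conj_gen_nonzero:
  assumes "d \<in> W" "1 \<le> x" "x \<in> X" "d + r x - d = r j" shows "j \<noteq> 0"
  using gen0_not_conj[OF W_uminus[OF assms(1)] assms(2,3)] assms(4)
  unfolding conj_eq_iff diff_minus_eq_add by metis

definition braid_pair :: "nat \<Rightarrow> nat \<Rightarrow> nat \<Rightarrow> bool" where
  "braid_pair s t m \<longleftrightarrow> 1 \<le> s \<and> 1 \<le> t \<and> s \<in> X \<and> t \<in> X \<and> s \<noteq> t \<and> p s t = enat m"

lemma braid_pairD:
  assumes "braid_pair s t m"
  shows "1 \<le> s" "1 \<le> t" "s \<in> X" "t \<in> X" "s \<noteq> t" "p s t = enat m" "2 \<le> m"
    and "ev (alt_word s t m) = ev (alt_word t s m)"
    and "{s, t} \<subseteq> X"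
proof -
  show *: "1 \<le> s" "1 \<le> t" "s \<in> X" "t \<in> X" "s \<noteq> t" "p s t = enat m"
    using assms unfolding braid_pair_def by blast+
  have "2 \<le> p s t" using p_sym * by blast
  then show "2 \<le> m" using *(6) by (metis enat_ord_simps(1) numeral_eq_enat)
  show "ev (alt_word s t m) = ev (alt_word t s m)" using braid[OF *] .
  show "{s, t} \<subseteq> X" using * by blast
qed

lemma braid_pair_sym: "braid_pair s t m \<Longrightarrow> braid_pair t s m"
  unfolding braid_pair_def using p_sym by metis

text \<open>Prepending \<open>s\<close> gives a trivial alternating word of length 2 (i + 1), that
  is, a braid relation of length i + 1, which \<open>m\<close> must divide.\<close>

lemma alt_refl_eq_gen_imp:
  assumes "braid_pair s t m" and "ev (alt_word t s (Suc (2 * i))) = r s"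
  shows "m \<le> Suc i"
proof -
  note st = braid_pairD[OF assms(1)]
  have "ev (alt_word s t (2 * Suc i)) = 0"
    using assms(2) involution[of s] st by simp
  then have "ev (alt_word s t (Suc i)) = ev (alt_word t s (Suc i))"
    using alt_double_eq_0 st by blast
  then obtain m' where "p s t = enat m'" "m' dvd Suc i"
    using braid_imp_dvd st by blast
  then show ?thesis using st by (simp add: dvd_imp_le)
qed

text \<open>Together with \<open>crosses_alt\<close> this identifies the positive side of the wall
  of \<open>s\<close> in the dihedral group: the alternating words of length below \<open>m\<close>
  that start with \<open>t\<close>.\<close>

lemma not_crosses_alt:
  assumes st: "braid_pair s t m" and "q < m"
  shows "\<not> crosses (ev (alt_word t s q)) (r s)"
proof
  assume *: "crosses (ev (alt_word t s q)) (r s)"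
  note D = braid_pairD[OF st]
  from crosses_imp_prefix[OF _ *] obtain u\<^sub>1 x b u\<^sub>2
    where u: "alt_word t s q = u\<^sub>1 @ (x, b) # u\<^sub>2" "r s = ev u\<^sub>1 + r x - ev u\<^sub>1"
    using D by auto
  define i where "i = length u\<^sub>1"
  have "u\<^sub>1 = alt_word t s i" "x = (if even i then t else s)" "i < q"
    using alt_word_prefix[OF u(1)] by (simp_all add: i_def)
  then have "ev (alt_word t s (Suc (2 * i))) = r s"
    using alt_conj[of t s i] D u(2) by (simp del: alt_word.simps(2))
  from alt_refl_eq_gen_imp[OF st this] \<open>i < q\<close> \<open>q < m\<close> show False by simp
qed

lemma crosses_alt:
  assumes st: "braid_pair s t m" and "0 < q" "q \<le> m"
  shows "crosses (ev (alt_word s t q)) (r s)"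
proof -
  note D = braid_pairD[OF st]
  obtain q' where q': "q = Suc q'" using \<open>0 < q\<close> by (cases q) auto
  have "\<not> crosses (ev (alt_word t s q')) (- r s + r s + r s)"
    using not_crosses_alt[OF st, of q'] assms q' by simp
  then show ?thesis
    using D crosses_add[OF W_closed(2)[OF D(3)] imageI[of "alt_word t s q'" "words X" ev], of "r s"]
      crosses_gen[of s] q' by simp
qed

text \<open>Prepending a letter cancels against an alternating word or lengthens it. At length
  \<open>m\<close> the braid relation can first exchange the starting letter, after which the new
  letter cancels.\<close>

lemma dihedral_cases:
  assumes st: "braid_pair s t m" and v: "v \<in> words {s, t}"
  shows "\<exists>q\<le>m. ev v = ev (alt_word s t q) \<or> ev v = ev (alt_word t s q)"
  using v
proof (induction v)
  case (Cons y v)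
  note D = braid_pairD[OF st]
  obtain x c where y: "y = (x, c)" "x = s \<or> x = t" using Cons.prems by (cases y) auto
  have ev: "ev (y # v) = r x + ev v"
    using y uminus_gen[of x] D by (cases c) auto
  have step: "\<exists>q'\<le>m. r x + ev (alt_word a b q) = ev (alt_word a b q') \<or>
      r x + ev (alt_word a b q) = ev (alt_word b a q')"
    if x: "x = a \<or> x = b" and pair: "braid_pair a b m" and q: "q \<le> m" for a b q
  proof -
    note D = braid_pairD[OF pair]
    have red: "r a + ev (alt_word a b (Suc q')) = ev (alt_word b a q')"
      and red': "r b + ev (alt_word b a (Suc q')) = ev (alt_word a b q')" for q'
      using involution[of a] involution[of b] D by (simp_all add: add.assoc[symmetric])
    consider "x = a" "q = 0" | q' where "x = a" "q = Suc q'" | "x = b" "q < m" | "x = b" "q = m"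
      using x q by (metis le_neq_implies_less not0_implies_Suc)
    then show ?thesis
    proof cases
      case 1
      then show ?thesis using D by (intro exI[of _ 1]) auto
    next
      case (2 q')
      then show ?thesis using red[of q'] q by (intro exI[of _ q']) auto
    next
      case 3
      then show ?thesis by (intro exI[of _ "Suc q"]) auto
    next
      case 4
      obtain m' where "m = Suc m'" using D by (cases m) auto
      then show ?thesis using 4 red'[of m'] D(8) by (intro exI[of _ m']) simp
    qed
  qed
  from Cons y(1) obtain q where q: "q \<le> m" "ev v = ev (alt_word s t q) \<or> ev v = ev (alt_word t s q)"
    by auto
  show ?case
    unfolding ev
    using q step[of s t q] step[of t s q] y(2) st braid_pair_sym[OF st] by metis
qed (auto intro!: exI[of _ 0])

text \<open>Take a shortest word representing an element of the coset. If it met a wall of the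
  coset, deleting the letter that meets it would give a shorter word in the same coset.\<close>

lemma ex_minimal_in_coset:
  assumes "d \<in> W" "T \<subseteq> X" and T: "\<And>s. s \<in> T \<Longrightarrow> 1 \<le> s"
  shows "\<exists>d\<^sub>0\<in>W. \<exists>v\<in>words T. d = d\<^sub>0 + ev v \<and> (\<forall>v'\<in>words T. \<not> crosses d\<^sub>0 (d\<^sub>0 + ev v' - d\<^sub>0))"
proof -
  define P where "P u \<longleftrightarrow> u \<in> words X \<and> (\<exists>v\<in>words T. d = ev u + ev v)" for u
  obtain u\<^sub>0 where "u\<^sub>0 \<in> words X" "d = ev u\<^sub>0" using assms by blast
  then have "P u\<^sub>0" by (auto simp: P_def intro!: bexI[of _ "[]"])
  from ex_has_least_nat[of P, OF this, of length] obtain u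
    where u: "P u" and least: "\<And>u'. P u' \<Longrightarrow> length u \<le> length u'" by blast
  obtain v where v: "u \<in> words X" "v \<in> words T" "d = ev u + ev v" using u by (auto simp: P_def)
  have "\<not> crosses (ev u) (ev u + ev v' - ev u)" if v': "v' \<in> words T" for v'
  proof
    assume "crosses (ev u) (ev u + ev v' - ev u)"
    from crosses_imp_prefix[OF v(1) this] obtain u\<^sub>1 x b u\<^sub>2
      where u12: "u = u\<^sub>1 @ (x, b) # u\<^sub>2" "x \<noteq> 0" "ev u + ev v' - ev u = ev u\<^sub>1 + r x - ev u\<^sub>1"
      by blast
    have x: "x \<in> X" "u\<^sub>1 \<in> words X" "u\<^sub>2 \<in> words X" using v(1) u12(1) by auto
    have "r x + r x = 0" "- r x = r x" using involution[of x] uminus_gen[of x] x u12(2) by auto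
    moreover from this have "r x + (r x + z) = z" for z by (simp add: add.assoc[symmetric])
    moreover have "ev u + ev v' = ev u\<^sub>1 + r x - ev u\<^sub>1 + ev u"
      using u12(3) by (simp add: diff_eq_eq)
    ultimately have "ev u + ev v' = ev u\<^sub>1 + (r x + r x) + ev u\<^sub>2"
      unfolding u12(1) by (cases b) (simp_all add: group_add_simps del: add_uminus_conv_diff)
    then have *: "ev u + ev v' = ev (u\<^sub>1 @ u\<^sub>2)" using \<open>r x + r x = 0\<close> by simp
    obtain v'' where v'': "v'' \<in> words T" "ev v'' = - ev v'" using uminus_in_parabolic v' by blast
    have "d = ev (u\<^sub>1 @ u\<^sub>2) + ev (v'' @ v)"
      using v(3) v''(2) *[symmetric] by (simp add: add.assoc)
    then have "P (u\<^sub>1 @ u\<^sub>2)" unfolding P_def using x v v'' by (intro conjI bexI[of _ "v'' @ v"]) auto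
    from least[OF this] show False using u12(1) by simp
  qed
  with v show ?thesis by blast
qed

subsection \<open>The retraction\<close>

text \<open>The elements on the positive side of the walls of \<open>J\<close>. Nothing is asked at \<open>a\<^sub>0\<close>, because
  only the braid relations need positivity.\<close>

definition D :: "nat set \<Rightarrow> 'w set" where
  "D J = {d \<in> W. \<forall>j\<in>J. j \<noteq> 0 \<longrightarrow> \<not> crosses d (r j)}"

text \<open>The output is a word because it is to be read in the Shephard group, whereas the state
  \<open>d\<close> lives in W.\<close>

fun retract :: "nat set \<Rightarrow> 'w \<Rightarrow> nat gword \<Rightarrow> nat gword" where
  "retract J d [] = []"
| "retract J d ((x, b) # u) =
     (if d + r x - d \<in> r ` J then (inv_into J r (d + r x - d), b) # retract J d u
      else retract J (d + (if b then r x else - r x)) u)"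

fun target :: "nat set \<Rightarrow> 'w \<Rightarrow> nat gword \<Rightarrow> 'w" where
  "target J d [] = d"
| "target J d ((x, b) # u) =
     (if d + r x - d \<in> r ` J then target J d u else target J (d + (if b then r x else - r x)) u)"

lemma target_append: "target J d (u @ v) = target J (target J d u) v"
  by (induction J d u rule: target.induct) auto

lemma retract_append: "retract J d (u @ v) = retract J d u @ retract J (target J d u) v"
  by (induction J d u rule: target.induct) auto

lemma retract_blocked:
  assumes "J \<subseteq> X" "j \<in> J" "d + r x - d = r j"
  shows "retract J d ((x, b) # u) = (j, b) # retract J d u" "target J d ((x, b) # u) = target J d u"
proof -
  have "inj_on r J" using assms(1) gen_inj by (meson inj_onI subsetD)
  then show "retract J d ((x, b) # u) = (j, b) # retract J d u" "target J d ((x, b) # u) = target J d u"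
    using assms by (auto simp: inv_into_f_f)
qed

text \<open>A step crosses at most the wall \<open>d + r x - d\<close>, which for an unblocked
  letter is no wall of \<open>J\<close>.\<close>

lemma D_step:
  assumes "d \<in> D J" "x \<in> X" "d + r x - d \<notin> r ` J"
  shows "d + r x \<in> D J" "d - r x \<in> D J"
proof -
  have "- d + r j + d \<noteq> r x" if "j \<in> J" for j
    using assms(3) that conj_eq_iff[of d "r x" "r j"] by auto
  moreover have d: "d \<in> W" "\<And>j. j \<in> J \<Longrightarrow> j \<noteq> 0 \<Longrightarrow> \<not> crosses d (r j)" using assms(1) by (auto simp: D_def)
  ultimately have "\<not> crosses (d + r x) (r j)" "\<not> crosses (d + - r x) (r j)" if "j \<in> J" "j \<noteq> 0" for j
    using that by (simp_all only: crosses_add[OF d(1) W_closed(2)[OF assms(2)]]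
        crosses_add[OF d(1) W_closed(3)[OF assms(2)]] crosses_gen[OF assms(2)]) auto
  moreover have "d + r x \<in> W" "d + - r x \<in> W"
    using d(1) W_closed(2,3)[OF assms(2)] W_closed(4) by blast+
  ultimately show "d + r x \<in> D J" "d - r x \<in> D J" unfolding D_def by auto
qed

lemma target_in_D: "d \<in> D J \<Longrightarrow> u \<in> words X \<Longrightarrow> target J d u \<in> D J"
proof (induction J d u rule: target.induct)
  case (2 J d x b u)
  then show ?case using D_step[of d J x] by (cases b) auto
qed simp

lemma retract_in_words: "J \<subseteq> X \<Longrightarrow> retract J d u \<in> words J"
  by (induction J d u rule: retract.induct) (auto simp: inv_into_into)

text \<open>At the state 0 a letter of \<open>J\<close> is blocked by its own wall. A prefix over
  \<open>J\<close> is thus copied while the state stays at 0, which is the source of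
  equivariance.\<close>

lemma retract_self: "u \<in> words J \<Longrightarrow> J \<subseteq> X \<Longrightarrow> retract J 0 u = u \<and> target J 0 u = 0"
proof (induction u)
  case (Cons y u)
  obtain x b where y: "y = (x, b)" by (cases y)
  have "x \<in> J" using Cons.prems y by auto
  moreover have "0 + r x - 0 = r x" by simp
  ultimately show ?case
    using Cons y retract_blocked[of J x 0 x b u] by simp
qed simp

text \<open>The state stays in the subgroup of \<open>K\<close>, so an emitted generator lies there
  too, and \<open>gen_in_parabolic_imp\<close> puts its index into \<open>K\<close>. Index 0 is
  emitted only by the letter 0.\<close>

lemma retract_parabolic:
  assumes "J \<subseteq> X" "K \<subseteq> X"
  shows "u \<in> words K \<Longrightarrow> d \<in> ev ` words K \<Longrightarrow> retract J d u \<in> words (J \<inter> K)"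
proof (induction u arbitrary: d)
  case (Cons y u)
  obtain x b where y: "y = (x, b)" by (cases y)
  have x: "x \<in> K" "u \<in> words K" using Cons.prems y by auto
  obtain w where w: "w \<in> words K" "d = ev w" using Cons.prems by blast
  have wX: "w \<in> words X" using words_mono[OF assms(2) w(1)] .
  show ?case
  proof (cases "d + r x - d \<in> r ` J")
    case True
    then obtain j where j: "j \<in> J" "d + r x - d = r j" by blast
    have "j \<in> K"
    proof (cases "j = 0")
      case True
      then have "x = 0" using conj_gen_nonzero[of d x j] j(2) w(2) wX x(1) assms(2) by fastforce
      then show ?thesis using x True by simp
    next
      case False
      obtain w' where w': "w' \<in> words K" "ev w' = - ev w" using uminus_in_parabolic w by blast
      have "r j = ev (w @ (x, True) # w')" using w w' by (simp add: j(2)[symmetric] group_add_simps del: add_uminus_conv_diff)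
      then have "r j \<in> ev ` words K" using w w' x by (intro image_eqI[of _ _ "w @ (x, True) # w'"]) auto
      then show ?thesis using gen_in_parabolic_imp[of j K] False j assms by auto
    qed
    then show ?thesis
      using y j Cons x retract_blocked[OF assms(1) j(1,2)] by simp
  next
    case False
    have "d + (if b then r x else - r x) = ev (w @ [(x, b)])" using w by (cases b) auto
    moreover have "w @ [(x, b)] \<in> words K" using w x by auto
    ultimately have "d + (if b then r x else - r x) \<in> ev ` words K" by blast
    then show ?thesis using Cons.IH x y False by simp
  qed
qed simp

lemma retract_unblocked:
  assumes "T \<subseteq> X" and "\<And>v x. v \<in> words T \<Longrightarrow> x \<in> T \<Longrightarrow> d + ev v + r x - (d + ev v) \<notin> r ` J"
  shows "v \<in> words T \<Longrightarrow> u \<in> words T \<Longrightarrow> retract J (d + ev v) u = [] \<and> target J (d + ev v) u = d + ev v + ev u"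
proof (induction u arbitrary: v)
  case (Cons y u)
  obtain x b where y: "y = (x, b)" by (cases y)
  then have x: "x \<in> T" "u \<in> words T" using Cons.prems by auto
  have "v @ [(x, b)] \<in> words T" using Cons.prems x by auto
  from Cons.IH[OF this x(2)] assms(2)[OF Cons.prems(1) x(1)] show ?case
    by (cases b) (auto simp: y group_add_simps simp del: add_uminus_conv_diff)
qed simp

lemma retract_both_blocked:
  assumes "J \<subseteq> X" "j \<in> J" "j' \<in> J" "d + r s - d = r j" "d + r t - d = r j'"
  shows "retract J d (alt_word s t q) = alt_word j j' q \<and> target J d (alt_word s t q) = d"
  using assms
proof (induction q arbitrary: s t j j')
  case (Suc q)
  then show ?case
    using retract_blocked[OF Suc.prems(1,2,4)] by simp
qed simp

text \<open>When only \<open>s\<close> is blocked at the minimal element \<open>d\<^sub>0\<close>, the representatives in the coset form a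
  path with \<open>m\<close> vertices. Either alternating word of length \<open>m\<close> walks to one of the two ends,
  is blocked there once, and walks back.\<close>

lemma retract_one_blocked:
  assumes pair: "braid_pair s t m" and J: "J \<subseteq> X" and v: "v \<in> words {s, t}"
    and min: "\<And>v x. v \<in> words {s, t} \<Longrightarrow> x \<in> {s, t} \<Longrightarrow> d\<^sub>0 + ev v + r x - (d\<^sub>0 + ev v) \<in> r ` J
      \<Longrightarrow> ev v + r x - ev v \<in> {r s, r t}"
    and s: "j \<in> J" "d\<^sub>0 + r s - d\<^sub>0 = r j" and t: "d\<^sub>0 + r t - d\<^sub>0 \<notin> r ` J"
    and v_pos: "\<not> crosses (ev v) (r s)"
  shows "retract J (d\<^sub>0 + ev v) (alt_word s t m) = retract J (d\<^sub>0 + ev v) (alt_word t s m) \<and>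
    target J (d\<^sub>0 + ev v) (alt_word s t m) = target J (d\<^sub>0 + ev v) (alt_word t s m)"
proof -
  note D = braid_pairD[OF pair]
  \<comment> \<open>The vertices of the path are \<open>pos l\<close> for l < m, numbered from the
    minimal end; \<open>f l\<close> leads outward from \<open>pos l\<close>.\<close>
  define pos where "pos l = d\<^sub>0 + ev (alt_word t s l)" for l
  define f where "f l = (if even l then t else s)" for l :: nat
  have f: "f l \<in> {s, t}" "f l \<in> X" "1 \<le> f l" "f (Suc (Suc l)) = f l" for l
    using D by (auto simp: f_def)
  have snoc: "alt_word t s (Suc l) = alt_word t s l @ [(f l, True)]" for l
    using alt_word_append[of t s l 1] by (auto simp: f_def)
  have pos_Suc: "pos (Suc l) = pos l + r (f l)" for l
    unfolding pos_def snoc by (simp add: add.assoc)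
  have conj_pos: "pos l + r (f l) - pos l = d\<^sub>0 + ev (alt_word t s (Suc (2 * l))) - d\<^sub>0" for l
  proof -
    have "pos l + r (f l) - pos l = d\<^sub>0 + (ev (alt_word t s l) + r (f l) - ev (alt_word t s l)) - d\<^sub>0"
      unfolding pos_def by (simp add: group_add_simps del: add_uminus_conv_diff)
    also have "ev (alt_word t s l) + r (f l) - ev (alt_word t s l) = ev (alt_word t s (Suc (2 * l)))"
      unfolding f_def by (rule alt_conj[OF D(2,1,4,3)])
    finally show ?thesis .
  qed
  \<comment> \<open>A blocked edge would have to be the wall that blocks \<open>s\<close> at
    \<open>d\<^sub>0\<close>, and exactness of the order allows this only for l >= m - 1.\<close>
  have free: "pos l + r (f l) - pos l \<notin> r ` J" if l: "Suc l < m" for l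
  proof
    assume *: "pos l + r (f l) - pos l \<in> r ` J"
    then have "ev (alt_word t s l) + r (f l) - ev (alt_word t s l) \<in> {r s, r t}"
      unfolding pos_def using f by (intro min) auto
    then have "ev (alt_word t s (Suc (2 * l))) \<in> {r s, r t}"
      using alt_conj[of t s l] D by (simp add: f_def del: alt_word.simps(2))
    moreover have "ev (alt_word t s (Suc (2 * l))) \<noteq> r t"
      using * t conj_pos[of l] by auto
    ultimately have "ev (alt_word t s (Suc (2 * l))) = r s" by blast
    from alt_refl_eq_gen_imp[OF pair this] l show False by simp
  qed
  have free': "pos (Suc l) + r (f l) - pos (Suc l) \<notin> r ` J" "pos (Suc l) + r (f l) = pos l" if l: "Suc l < m" for l
    using free[OF l] involution[OF f(3,2)[of l]] uminus_gen[OF f(3,2)[of l]]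
    by (simp_all add: pos_Suc group_add_simps del: add_uminus_conv_diff)
  obtain m' where m': "m = Suc m'" using D by (cases m) auto
  \<comment> \<open>The alternating word of length 2m - 1 starting with \<open>t\<close> equals
    \<open>s\<close>. So the outward letter at the far end is blocked by the same wall as
    \<open>s\<close> at \<open>d\<^sub>0\<close>, and both ends emit \<open>j\<close>.\<close>
  have "r s + ev (alt_word t s (Suc (2 * m'))) = ev (alt_word s t (m + m))"
    using m' by (simp add: mult_2)
  also have "\<dots> = ev (alt_word s t m) + (if even m then ev (alt_word s t m) else ev (alt_word t s m))"
    by (simp add: alt_word_append)
  also have "\<dots> = ev (alt_word s t m) - ev (alt_word t s m)"
    using alt_uminus[of t s m] D by (simp only: diff_conv_add_uminus split: if_splits)
  finally have "ev (alt_word t s (Suc (2 * m'))) = r s"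
    using D(8) uminus_gen[OF D(1,3)] by (metis add_eq_0_iff diff_self)
  then have loop: "pos m' + r (f m') - pos m' = r j"
    using conj_pos[of m'] s by simp
  have loop': "pos 0 + r s - pos 0 = r j"
    using s by (simp add: pos_def)
  have fwd: "retract J (pos l) (alt_word (f l) (f (Suc l)) q) = [] \<and>
      target J (pos l) (alt_word (f l) (f (Suc l)) q) = pos (l + q)" if "l + q \<le> m'" for l q
    using that
  proof (induction q arbitrary: l)
    case (Suc q)
    then show ?case
      using free[of l] Suc.IH[of "Suc l"] m' f(4)[of l] by (simp add: pos_Suc[symmetric])
  qed simp
  have bwd: "retract J (pos l) (alt_word (f (Suc l)) (f l) q) = [] \<and>
      target J (pos l) (alt_word (f (Suc l)) (f l) q) = pos (l - q)" if "q \<le> l" "l \<le> m'" for l q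
    using that
  proof (induction q arbitrary: l)
    case (Suc q)
    then obtain l' where l': "l = Suc l'" by (cases l) auto
    then show ?case
      using free'[of l'] Suc.IH[of l'] Suc.prems m' f(4)[of l'] by simp
  qed simp
  \<comment> \<open>A nonempty word starting with \<open>s\<close> lies across the wall of
    \<open>s\<close>, against \<open>v_pos\<close>. Length \<open>m\<close> is excluded because the
    two words of that length coincide.\<close>
  obtain l where l: "l \<le> m'" "d\<^sub>0 + ev v = pos l"
  proof -
    obtain q where q: "q \<le> m" "ev v = ev (alt_word s t q) \<or> ev v = ev (alt_word t s q)"
      using dihedral_cases[OF pair v] by blast
    show ?thesis
    proof (cases "q = 0")
      case True
      then show ?thesis using q that[of 0] by (simp add: pos_def)
    next
      case False
      then have "ev v \<noteq> ev (alt_word s t q)" using crosses_alt[OF pair, of q] q(1) v_pos by auto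
      moreover from this have "q \<noteq> m" using q(2) D(8) by auto
      ultimately show ?thesis using q that[of q] m' by (simp add: pos_def)
    qed
  qed
  \<comment> \<open>One word takes m' - l steps outward, is blocked, and takes l steps back; the
    other takes l steps back, is blocked, and takes m' - l steps outward. Both stop at
    \<open>pos (m' - l)\<close>.\<close>
  have "m = (m' - l) + Suc l" using l m' by simp
  then have w1: "alt_word (f l) (f (Suc l)) m
      = alt_word (f l) (f (Suc l)) (m' - l) @ (f m', True) # alt_word (f (Suc m')) (f m') l"
    using alt_word_append[of "f l" "f (Suc l)" "m' - l" "Suc l"] l
    by (auto simp: f_def)
  have "m = l + Suc (m' - l)" using l m' by simp
  then have w2: "alt_word (f (Suc l)) (f l) m
      = alt_word (f (Suc l)) (f l) l @ (s, True) # alt_word (f 0) (f (Suc 0)) (m' - l)"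
    using alt_word_append[of "f (Suc l)" "f l" l "Suc (m' - l)"] l
    by (auto simp: f_def)
  have r1: "retract J (pos l) (alt_word (f l) (f (Suc l)) m) = [(j, True)] \<and>
      target J (pos l) (alt_word (f l) (f (Suc l)) m) = pos (m' - l)"
    unfolding w1 retract_append target_append
    using fwd[of l "m' - l"] bwd[of l m'] l retract_blocked[OF J s(1) loop] by simp
  have r2: "retract J (pos l) (alt_word (f (Suc l)) (f l) m) = [(j, True)] \<and>
      target J (pos l) (alt_word (f (Suc l)) (f l) m) = pos (m' - l)"
    unfolding w2 retract_append target_append
    using bwd[of l l] fwd[of 0 "m' - l"] l retract_blocked[OF J s(1) loop'] by simp
  show ?thesis
    using r1 r2 l(2) by (cases "even l") (simp_all add: f_def)
qed

lemma retract_braid: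
  assumes pair: "braid_pair s t m" and J: "J \<subseteq> X" and d: "d \<in> D J"
  shows "target J d (alt_word s t m) = target J d (alt_word t s m) \<and>
    pres_eq X (shephard_relations n k p) (retract J d (alt_word s t m)) (retract J d (alt_word t s m))"
proof -
  note D = braid_pairD[OF pair]
  have dW: "d \<in> W" using d by (simp add: D_def)
  have T: "\<And>x. x \<in> {s, t} \<Longrightarrow> 1 \<le> x" using D by blast
  obtain d\<^sub>0 v where d0: "d\<^sub>0 \<in> W" and v: "v \<in> words {s, t}" and dv: "d = d\<^sub>0 + ev v"
    and min: "\<And>v'. v' \<in> words {s, t} \<Longrightarrow> \<not> crosses d\<^sub>0 (d\<^sub>0 + ev v' - d\<^sub>0)"
    using ex_minimal_in_coset[OF dW D(9) T] by blast
  have in_W: "ev v' \<in> W" if "v' \<in> words {s, t}" for v'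
    using words_mono[OF D(9) that] by blast
  have simple: "ev v' \<in> {r s, r t}"
    if j: "j \<in> J" "1 \<le> j" and v': "v' \<in> words {s, t}" and eq: "d\<^sub>0 + ev v' - d\<^sub>0 = r j" for j v'
  proof -
    \<comment> \<open>Count the crossings of \<open>?t\<close> on both sides of
      \<open>d\<^sub>0 + ev v' = r j + d\<^sub>0\<close>. Minimality removes the contributions of
      \<open>d\<^sub>0\<close>, so \<open>ev v'\<close> crosses no wall of the dihedral group but
      its own. As an alternating word it also crosses the wall of its first letter, hence equals
      that letter.\<close>
    have crosses: "crosses (ev v') (ev w) \<longleftrightarrow> ev w = ev v'" if w: "w \<in> words {s, t}" for w
    proof -
      let ?t = "d\<^sub>0 + ev w - d\<^sub>0"
      obtain v'' where v'': "v'' \<in> words {s, t}" "ev v'' = - ev v'" using uminus_in_parabolic v' by blast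
      have "d\<^sub>0 + ev v' = r j + d\<^sub>0" using eq by (simp add: diff_eq_eq)
      moreover have "- d\<^sub>0 + ?t + d\<^sub>0 = ev w" by (simp add: group_add_simps del: add_uminus_conv_diff)
      moreover have "- r j + ?t + r j = d\<^sub>0 + ev (v'' @ w @ v') - d\<^sub>0"
        unfolding eq[symmetric] using v''(2) by (simp add: group_add_simps del: add_uminus_conv_diff)
      moreover have "\<not> crosses d\<^sub>0 (d\<^sub>0 + ev (v'' @ w @ v') - d\<^sub>0)"
        using v'' v' w by (intro min) auto
      moreover have "j \<in> X" using j J by blast
      ultimately have "crosses (ev v') (ev w) \<longleftrightarrow> ?t = r j"
        using crosses_add[OF d0 in_W[OF v'], of ?t] crosses_add[OF W_closed(2) d0, of j ?t]
          crosses_gen(1)[of j ?t] min[OF w] j(2) by auto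
      also have "\<dots> \<longleftrightarrow> ev w = ev v'" unfolding eq[symmetric]
        by (metis add_left_cancel diff_add_cancel)
      finally show ?thesis .
    qed
    obtain a b q where q: "q \<le> m" "ev v' = ev (alt_word a b q)" and ab: "braid_pair a b m" "{a, b} = {s, t}"
      using dihedral_cases[OF pair v'] pair braid_pair_sym[OF pair] by blast
    have "q \<noteq> 0" using crosses[of "[]"] q by (cases q) auto
    then have "crosses (ev v') (ev [(a, True)])" using crosses_alt[OF ab(1), of q] q by simp
    moreover have "[(a, True)] \<in> words {s, t}" using ab(2) by auto
    ultimately have "ev v' = r a" using crosses[of "[(a, True)]"] by auto
    then show ?thesis using ab(2) by auto
  qed
  have blocked: "ev w + r x - ev w \<in> {r s, r t}"
    if w: "w \<in> words {s, t}" and x: "x \<in> {s, t}" and bl: "d\<^sub>0 + ev w + r x - (d\<^sub>0 + ev w) \<in> r ` J" for w x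
  proof -
    obtain j where j: "j \<in> J" "d\<^sub>0 + ev w + r x - (d\<^sub>0 + ev w) = r j" using bl by blast
    have "d\<^sub>0 + ev w \<in> W" using W_closed(4)[OF d0 in_W[OF w]] .
    then have "j \<noteq> 0" using conj_gen_nonzero[OF _ _ _ j(2)] x D by blast
    obtain w' where w': "w' \<in> words {s, t}" "ev w' = - ev w" using uminus_in_parabolic w by blast
    have "d\<^sub>0 + ev (w @ (x, True) # w') - d\<^sub>0 = r j"
      using j(2) w'(2) by (simp add: group_add_simps del: add_uminus_conv_diff)
    then have "ev (w @ (x, True) # w') \<in> {r s, r t}"
      using simple[OF j(1), of "w @ (x, True) # w'"] \<open>j \<noteq> 0\<close> w w' x by simp
    then show ?thesis using w'(2) by (simp add: group_add_simps del: add_uminus_conv_diff)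
  qed
  have not_crosses_v: "\<not> crosses (ev v) (r x)" if j: "j \<in> J" "d\<^sub>0 + r x - d\<^sub>0 = r j" and x: "x \<in> {s, t}" for x j
  proof -
    have "j \<noteq> 0" using conj_gen_nonzero[OF d0 _ _ j(2)] x D by blast
    then have "\<not> crosses (d\<^sub>0 + ev v) (r j)" using d j(1) by (simp add: D_def dv)
    moreover have "\<not> crosses d\<^sub>0 (r j)" using min[of "[(x, True)]"] x j(2) by auto
    moreover have "- d\<^sub>0 + r j + d\<^sub>0 = r x" using j(2) by (simp add: conj_eq_iff)
    ultimately show ?thesis using crosses_add[OF d0 in_W[OF v], of "r j"] by simp
  qed
  have refl: "pres_eq X (shephard_relations n k p) (retract J d u) (retract J d u)" for u
    using retract_in_words[OF J] words_mono[OF J] by (blast intro: pres_eq.refl)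
  consider (none) "d\<^sub>0 + r s - d\<^sub>0 \<notin> r ` J" "d\<^sub>0 + r t - d\<^sub>0 \<notin> r ` J"
    | (s) j where "j \<in> J" "d\<^sub>0 + r s - d\<^sub>0 = r j" "d\<^sub>0 + r t - d\<^sub>0 \<notin> r ` J"
    | (t) j where "j \<in> J" "d\<^sub>0 + r t - d\<^sub>0 = r j" "d\<^sub>0 + r s - d\<^sub>0 \<notin> r ` J"
    | (both) j j' where "j \<in> J" "d\<^sub>0 + r s - d\<^sub>0 = r j" "j' \<in> J" "d\<^sub>0 + r t - d\<^sub>0 = r j'"
    by blast
  then show ?thesis
  proof cases
    case none
    have "d\<^sub>0 + ev w + r x - (d\<^sub>0 + ev w) \<notin> r ` J" if "w \<in> words {s, t}" "x \<in> {s, t}" for w x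
    proof
      assume *: "d\<^sub>0 + ev w + r x - (d\<^sub>0 + ev w) \<in> r ` J"
      have "d\<^sub>0 + ev w + r x - (d\<^sub>0 + ev w) = d\<^sub>0 + (ev w + r x - ev w) - d\<^sub>0"
        by (simp add: group_add_simps del: add_uminus_conv_diff)
      then show False using blocked[OF that *] * none by auto
    qed
    from retract_unblocked[OF D(9) this v] show ?thesis
      using D(8) pres_eq.refl[of "[]" X] by (simp add: dv)
  next
    case (s j)
    from retract_one_blocked[OF pair J v blocked s not_crosses_v[OF s(1,2)]] refl show ?thesis
      by (simp add: dv)
  next
    case (t j)
    have sw: "{t, s} = {s, t}" by blast
    have "retract J d (alt_word t s m) = retract J d (alt_word s t m) \<and>
        target J d (alt_word t s m) = target J d (alt_word s t m)"
      unfolding dv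
    proof (rule retract_one_blocked[OF braid_pair_sym[OF pair] J])
      show "v \<in> words {t, s}" using v sw by simp
      show "ev w + r x - ev w \<in> {r t, r s}"
        if "w \<in> words {t, s}" "x \<in> {t, s}" "d\<^sub>0 + ev w + r x - (d\<^sub>0 + ev w) \<in> r ` J" for w x
        using blocked[of w x] that unfolding sw by blast
      show "\<not> crosses (ev v) (r t)" using not_crosses_v[OF t(1,2)] by simp
    qed (fact t)+
    with refl show ?thesis by metis
  next
    case (both j j')
    \<comment> \<open>By positivity \<open>ev v\<close> crosses neither wall, so \<open>d\<close> is
      the minimal element itself and the walk never moves.\<close>
    obtain a b q where q: "q \<le> m" "ev v = ev (alt_word a b q)" and ab: "braid_pair a b m" "{a, b} = {s, t}"
      using dihedral_cases[OF pair v] pair braid_pair_sym[OF pair] by blast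
    have "\<not> crosses (ev v) (r a)"
      using not_crosses_v[OF both(1,2)] not_crosses_v[OF both(3,4)] ab(2) by auto
    then have "q = 0" using crosses_alt[OF ab(1), of q] q by auto
    then have "d = d\<^sub>0" using q dv by simp
    note st = both(2,4)[folded \<open>d = d\<^sub>0\<close>]
    have "j \<noteq> 0" "j' \<noteq> 0" using conj_gen_nonzero[OF dW _ _ st(1)] conj_gen_nonzero[OF dW _ _ st(2)] D by blast+
    moreover have "j \<in> X" "j' \<in> X" using both J by auto
    moreover have "j \<noteq> j'" using st gen_inj D(3,4,5) by (metis add_diff_cancel add_left_cancel diff_add_cancel)
    ultimately have jj: "1 \<le> j" "1 \<le> j'" "j \<in> X" "j' \<in> X" "j \<noteq> j'" by auto
    have alt: "ev (alt_word j j' q) = d + ev (alt_word s t q) - d"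
      if "d + r s - d = r j" "d + r t - d = r j'" for s t j j' q
      using that
    proof (induction q arbitrary: s t j j')
      case (Suc q)
      then show ?case
        using Suc.IH[of t j' s j] by (simp add: Suc.prems(1)[symmetric] group_add_simps del: add_uminus_conv_diff)
    qed simp
    \<comment> \<open>Conjugation by \<open>d\<close> carries braid relations between (s, t) and (j,
      j') both ways, so \<open>p j j'\<close> and \<open>m\<close> divide each other.\<close>
    have "ev (alt_word j j' m) = ev (alt_word j' j m)"
      using alt[OF st] alt[OF st(2,1)] D(8) by simp
    then obtain m' where m': "p j j' = enat m'" "m' dvd m"
      using braid_imp_dvd[OF jj, of m] D(7) by auto
    have "2 \<le> m'" using p_sym[of j j'] jj m' by (metis enat_ord_simps(1) numeral_eq_enat)
    have "ev (alt_word j j' m') = ev (alt_word j' j m')" using braid[OF jj m'(1)] .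
    then have "ev (alt_word s t m') = ev (alt_word t s m')"
      unfolding alt[OF st] alt[OF st(2,1)] by (metis add_left_cancel diff_add_cancel)
    then have "m dvd m'"
      using braid_imp_dvd[OF D(1-5), of m'] D(6) \<open>2 \<le> m'\<close> by auto
    with m' have p: "p j j' = enat m" by (simp add: dvd_antisym)
    have rel: "pres_eq X (shephard_relations n k p) (alt_word a b m) (alt_word b a m)"
      if "1 \<le> a" "a < b" "b \<in> X" "p a b = enat m" for a b
    proof (rule pres_eq.rel)
      show "(alt_word a b m, alt_word b a m) \<in> shephard_relations n k p"
        using that unfolding shephard_relations_def by auto
    qed (use that in auto)
    have "pres_eq X (shephard_relations n k p) (alt_word j j' m) (alt_word j' j m)"
    proof (cases "j < j'")
      case True
      then show ?thesis using rel jj p by blast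
    next
      case False
      then have "j' < j" "p j' j = enat m" using jj p p_sym[of j j'] by auto
      then show ?thesis using rel jj by (blast intro: pres_eq.sym)
    qed
    then show ?thesis
      using retract_both_blocked[OF J both(1,3) st, of m] retract_both_blocked[OF J both(3,1) st(2,1), of m]
      by simp
  qed
qed

text \<open>A blocked a_0 can only emit a_0, so the output is the relator itself. An unblocked one
  returns to \<open>d\<close> after k steps in W, and the conjugate deciding about blocking never
  changes on the way.\<close>

lemma retract_gen0_power:
  assumes J: "J \<subseteq> X" and d: "d \<in> W"
  shows "target J d (replicate k (0, True)) = d \<and>
    pres_eq X (shephard_relations n k p) (retract J d (replicate k (0, True))) []"
proof (cases "d + r 0 - d \<in> r ` J")
  case True
  then obtain j where j: "j \<in> J" "d + r 0 - d = r j" by blast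
  then have "j = 0" using gen0_not_conj[OF d, of j] J by (cases "j = 0") auto
  then have "retract J d (replicate q (0, True)) = replicate q (0, True) \<and>
      target J d (replicate q (0, True)) = d" for q
    using retract_blocked[OF J j] by (induction q) auto
  moreover have "pres_eq X (shephard_relations n k p) (replicate k (0, True)) []"
    by (rule pres_eq.rel) (auto simp: shephard_relations_def words_def)
  ultimately show ?thesis by simp
next
  case False
  have "retract J d' (replicate q (0, True)) = [] \<and>
      target J d' (replicate q (0, True)) = d' + ev (replicate q (0, True))"
    if "d' + r 0 - d' = d + r 0 - d" for d' q
    using that
  proof (induction q arbitrary: d')
    case (Suc q)
    have "d' + r 0 + r 0 - (d' + r 0) = d + r 0 - d"
      unfolding Suc.prems[symmetric] by (simp add: group_add_simps del: add_uminus_conv_diff)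
    from Suc.IH[OF this] show ?case using Suc.prems False by (simp add: add.assoc)
  qed simp
  moreover have "ev (replicate k (0, True)) = 0"
    using ev_rel[of "replicate k (0, True)" "[]"]
    by (simp add: dyer_relations_def shephard_relations_def words_def in_lists_conv_set)
  ultimately show ?thesis using pres_eq.refl[of "[]" X] by simp
qed

text \<open>Moving along one of two commuting letters does not change the conjugate of the other, so
  all blocking is decided at \<open>d\<close>.\<close>

lemma retract_gen0_commute:
  assumes J: "J \<subseteq> X" and d: "d \<in> W" and i: "2 \<le> i" "i \<in> X"
  shows "target J d [(0, True), (i, True)] = target J d [(i, True), (0, True)] \<and>
    pres_eq X (shephard_relations n k p)
      (retract J d [(0, True), (i, True)]) (retract J d [(i, True), (0, True)])"
proof -
  have comm: "r 0 + r i = r i + r 0" using gen0_commute i by blast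
  have d0: "d + r 0 + r i - (d + r 0) = d + r i - d"
  proof -
    have "d + r 0 + r i - (d + r 0) = d + (r 0 + r i) - (d + r 0)" by (simp add: add.assoc)
    then show ?thesis unfolding comm by (simp add: group_add_simps del: add_uminus_conv_diff)
  qed
  have di: "d + r i + r 0 - (d + r i) = d + r 0 - d"
  proof -
    have "d + r i + r 0 - (d + r i) = d + (r i + r 0) - (d + r i)" by (simp add: add.assoc)
    then show ?thesis unfolding comm[symmetric] by (simp add: group_add_simps del: add_uminus_conv_diff)
  qed
  have end_eq: "d + r 0 + r i = d + r i + r 0" using comm by (simp add: add.assoc)
  have refl: "pres_eq X (shephard_relations n k p) (retract J e u) (retract J e u)" for e u
    using retract_in_words[OF J] words_mono[OF J] by (blast intro: pres_eq.refl)
  show ?thesis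
  proof (cases "d + r 0 - d \<in> r ` J \<and> d + r i - d \<in> r ` J")
    case True
    then obtain j j' where j: "j \<in> J" "d + r 0 - d = r j" and j': "j' \<in> J" "d + r i - d = r j'"
      by blast
    have "j = 0" using gen0_not_conj[OF d, of j] j J by (cases "j = 0") auto
    have "j' \<noteq> 0" using conj_gen_nonzero[OF d _ _ j'(2)] i by auto
    \<comment> \<open>The emitted letters are conjugate to a commuting pair, so \<open>j'\<close> is
      not 1 and the needed commutation is a relation of the Shephard group.\<close>
    have "r 0 + r j' = d + (r 0 + r i) - d"
      using j j' unfolding \<open>j = 0\<close> by (metis add.assoc add_diff_eq diff_add_cancel)
    also have "\<dots> = r j' + r 0"
      using j j' unfolding \<open>j = 0\<close> comm by (metis add.assoc add_diff_eq diff_add_cancel)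
    finally have "j' \<noteq> 1" using gen0_gen1_not_commute by metis
    then have "2 \<le> j'" "j' \<in> X" using \<open>j' \<noteq> 0\<close> j' J by auto
    then have "pres_eq X (shephard_relations n k p) [(0, True), (j', True)] [(j', True), (0, True)]"
      by (intro pres_eq.rel) (auto simp: shephard_relations_def)
    then show ?thesis
      using retract_blocked[OF J j] retract_blocked[OF J j'] \<open>j = 0\<close> by simp
  next
    case False
    then consider "d + r 0 - d \<notin> r ` J" "d + r i - d \<notin> r ` J"
      | j where "j \<in> J" "d + r 0 - d = r j" "d + r i - d \<notin> r ` J"
      | j where "j \<in> J" "d + r i - d = r j" "d + r 0 - d \<notin> r ` J"
      by blast
    then show ?thesis
    proof cases
      case 1
      then show ?thesis using d0 di end_eq pres_eq.refl[of "[]" X] by simp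
    next
      case (2 j)
      then have "retract J d [(0, True), (i, True)] = [(j, True)]"
        "retract J d [(i, True), (0, True)] = [(j, True)]"
        using retract_blocked[OF J 2(1,2)] retract_blocked[OF J 2(1), of "d + r i" 0] di by simp_all
      moreover have "target J d [(0, True), (i, True)] = d + r i"
        "target J d [(i, True), (0, True)] = d + r i"
        using 2 di by auto
      ultimately show ?thesis using refl by metis
    next
      case (3 j)
      then have "retract J d [(0, True), (i, True)] = [(j, True)]"
        "retract J d [(i, True), (0, True)] = [(j, True)]"
        using retract_blocked[OF J 3(1,2)] retract_blocked[OF J 3(1), of "d + r 0" i] d0 by simp_all
      moreover have "target J d [(0, True), (i, True)] = d + r 0"
        "target J d [(i, True), (0, True)] = d + r 0"
        using 3 d0 by auto
      ultimately show ?thesis using refl by metis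
    qed
  qed
qed

text \<open>Quantifying over all states and tracking \<open>target\<close> as well lets the claim
  pass to concatenations.\<close>

lemma pres_eq_retract:
  assumes J: "J \<subseteq> X"
  shows "pres_eq X (shephard_relations n k p) u v \<Longrightarrow> d \<in> D J \<Longrightarrow>
    target J d u = target J d v \<and>
    pres_eq X (shephard_relations n k p) (retract J d u) (retract J d v)"
proof (induction arbitrary: d rule: pres_eq.induct)
  case (refl u)
  then show ?case using retract_in_words[OF J] words_mono[OF J] by (blast intro: pres_eq.refl)
next
  case (sym u v)
  then show ?case by (metis pres_eq.sym)
next
  case (trans u v w)
  then show ?case by (metis pres_eq.trans)
next
  case (cancel x b)
  show ?case
  proof (cases "d + r x - d \<in> r ` J")
    case True
    then obtain j where j: "j \<in> J" "d + r x - d = r j" by blast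
    then have "j \<in> X" using J by blast
    then show ?thesis
      using retract_blocked[OF J j] pres_eq.cancel[of j X] by simp
  next
    case False
    moreover have "d + r x + r x - (d + r x) = d + r x - d" "d - r x + r x - (d - r x) = d + r x - d"
      by (simp_all add: group_add_simps del: add_uminus_conv_diff)
    ultimately show ?thesis using pres_eq.refl[of "[]" X] by (cases b) simp_all
  qed
next
  case (rel l r')
  then have dW: "d \<in> W" by (simp add: D_def)
  from rel(1) consider
      "l = replicate k (0, True)" "r' = []"
    | i where "l = [(0, True), (i, True)]" "r' = [(i, True), (0, True)]" "2 \<le> i" "i \<le> n - 1"
    | i j m where "l = alt_word i j m" "r' = alt_word j i m" "1 \<le> i" "i < j" "j \<le> n - 1" "p i j = enat m"
    unfolding shephard_relations_def by blast
  then show ?case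
  proof cases
    case 1
    then show ?thesis using retract_gen0_power[OF J dW] by simp
  next
    case (2 i)
    then show ?thesis using retract_gen0_commute[OF J dW, of i] by (simp only: atLeastAtMost_iff) blast
  next
    case (3 i j m)
    then have "braid_pair i j m" by (auto simp: braid_pair_def)
    then show ?thesis using 3 retract_braid J rel(4) by blast
  qed
next
  case (mult u u' v v')
  have "target J d u \<in> D J"
    using target_in_D[OF mult.prems] mult.hyps pres_eq_words by blast
  then show ?case
    using mult.IH(1)[OF mult.prems] mult.IH(2)[of "target J d u"]
    by (simp add: retract_append target_append pres_eq.mult)
qed

end

section \<open>Consequences of the existence of retractions\<close>

locale parabolic_retractions = group +
  fixes X :: "'i set" and P :: "'i set \<Rightarrow> 'a set" and \<pi> :: "'i set \<Rightarrow> 'a \<Rightarrow> 'a"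
  assumes subgroup: "J \<subseteq> X \<Longrightarrow> subgroup (P J) G"
    and mono: "J \<subseteq> K \<Longrightarrow> K \<subseteq> X \<Longrightarrow> P J \<subseteq> P K"
    and total: "P X = carrier G"
    and equivariant: "J \<subseteq> X \<Longrightarrow> h \<in> P J \<Longrightarrow> g \<in> carrier G \<Longrightarrow> \<pi> J (h \<otimes> g) = h \<otimes> \<pi> J g"
    and fixes_one: "J \<subseteq> X \<Longrightarrow> \<pi> J \<one> = \<one>"
    and parabolic: "J \<subseteq> X \<Longrightarrow> K \<subseteq> X \<Longrightarrow> g \<in> P K \<Longrightarrow> \<pi> J g \<in> P (J \<inter> K)"
begin

lemma mem_P_carrier: "J \<subseteq> X \<Longrightarrow> g \<in> P J \<Longrightarrow> g \<in> carrier G"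
  using subgroup subgroup.mem_carrier by metis

lemma P_Int:
  assumes "J \<subseteq> X" "K \<subseteq> X"
  shows "P J \<inter> P K = P (J \<inter> K)"
proof
  show "P (J \<inter> K) \<subseteq> P J \<inter> P K"
    using mono[of "J \<inter> K" J] mono[of "J \<inter> K" K] assms by blast
  show "P J \<inter> P K \<subseteq> P (J \<inter> K)"
  proof
    fix g assume g: "g \<in> P J \<inter> P K"
    then have "\<pi> J g = g"
      using equivariant[of J g \<one>] fixes_one[of J] mem_P_carrier[of J g] assms by simp
    then show "g \<in> P (J \<inter> K)" using parabolic[of J K g] g assms by simp
  qed
qed

lemma P_mult_Int:
  assumes J: "J \<subseteq> X" and K: "K \<subseteq> X" and L: "L \<subseteq> X"
  shows "(P J <#> P K) \<inter> (P J <#> P L) = P J <#> (P K \<inter> P L)"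
proof
  show "P J <#> (P K \<inter> P L) \<subseteq> (P J <#> P K) \<inter> (P J <#> P L)"
    by (auto simp: set_mult_def)
  show "(P J <#> P K) \<inter> (P J <#> P L) \<subseteq> P J <#> (P K \<inter> P L)"
  proof
    fix g assume "g \<in> (P J <#> P K) \<inter> (P J <#> P L)"
    then obtain h x h' y where g: "g = h \<otimes> x" "g = h' \<otimes> y"
      and h: "h \<in> P J" "h' \<in> P J" and x: "x \<in> P K" and y: "y \<in> P L"
      unfolding set_mult_def by blast
    interpret J: subgroup "P J" G by (rule subgroup[OF J])
    interpret K: subgroup "P K" G by (rule subgroup[OF K])
    interpret L: subgroup "P L" G by (rule subgroup[OF L])
    define j where "j = inv h \<otimes> h'"
    have j: "j \<in> P J" using h by (simp add: j_def)
    have xjy: "x = j \<otimes> y"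
      using g h x y by (simp add: j_def m_assoc inv_solve_left)
    \<comment> \<open>The projections lie in \<open>P J\<close> and also in \<open>P K\<close> and
      \<open>P L\<close> respectively. Dividing them out leaves one element common to
      \<open>P K\<close> and \<open>P L\<close>.\<close>
    define u v where "u = \<pi> J x" and "v = \<pi> J y"
    have u: "u \<in> P J" "u \<in> P K"
      using parabolic[OF J K x] P_Int[OF J K] by (auto simp: u_def)
    have v: "v \<in> P J" "v \<in> P L"
      using parabolic[OF J L y] P_Int[OF J L] by (auto simp: v_def)
    have "u = j \<otimes> v"
      using equivariant[OF J j, of y] y by (simp add: u_def v_def xjy)
    then have "inv u \<otimes> x = inv v \<otimes> y"
      using xjy j u v y x by (simp add: inv_mult_group m_assoc) (simp add: m_assoc[symmetric])
    then have "inv u \<otimes> x \<in> P K \<inter> P L"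
      using u v x y by (metis IntI K.m_closed K.m_inv_closed L.m_closed L.m_inv_closed)
    moreover have "g = (h \<otimes> u) \<otimes> (inv u \<otimes> x)"
      using g(1) h u x by (simp add: m_assoc) (simp add: m_assoc[symmetric])
    moreover have "h \<otimes> u \<in> P J" using h u by simp
    ultimately show "g \<in> P J <#> (P K \<inter> P L)" by (auto simp: set_mult_def)
  qed
qed

text \<open>Intersecting with \<open>X\<close> gives the empty family the value \<open>P X\<close>,
  the whole group.\<close>

lemma P_mult_Inter:
  assumes "finite F" "J \<subseteq> X" "z \<in> carrier G" "\<And>i. i \<in> F \<Longrightarrow> K i \<subseteq> X"
    and "\<And>i. i \<in> F \<Longrightarrow> z \<in> P J <#> P (K i)"
  shows "z \<in> P J <#> P (X \<inter> (\<Inter>i\<in>F. K i))"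
  using assms(1,4,5)
proof (induction F)
  case empty
  have "\<one> \<in> P J" using assms(2) subgroup.one_closed[OF subgroup] by blast
  then have "\<one> \<otimes> z \<in> P J <#> P X" using assms(3) unfolding set_mult_def total by blast
  then show ?case using assms(3) by simp
next
  case (insert i F)
  then have "z \<in> (P J <#> P (K i)) \<inter> (P J <#> P (X \<inter> (\<Inter>i\<in>F. K i)))" by simp
  also have "\<dots> = P J <#> P (K i \<inter> (X \<inter> (\<Inter>i\<in>F. K i)))"
    using insert.prems assms(2) by (simp add: P_mult_Int P_Int)
  also have "K i \<inter> (X \<inter> (\<Inter>i\<in>F. K i)) = X \<inter> (\<Inter>i\<in>insert i F. K i)" by auto
  finally show ?case .
qed

text \<open>For a point \<open>y\<close> of the cosets in \<open>F\<close>, pairwise intersection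
  puts \<open>inv (g l) \<otimes> y\<close> into every product \<open>P (K l) <#> P (K i)\<close>,
  hence into the product with the common intersection. Its second factor corrects \<open>y\<close>
  without leaving the cosets in \<open>F\<close>.\<close>

lemma cosets_Helly:
  assumes "finite F" "\<And>i. i \<in> F \<Longrightarrow> g i \<in> carrier G" "\<And>i. i \<in> F \<Longrightarrow> K i \<subseteq> X"
    and "\<And>i j. i \<in> F \<Longrightarrow> j \<in> F \<Longrightarrow> (g i <# P (K i)) \<inter> (g j <# P (K j)) \<noteq> {}"
  shows "\<exists>y\<in>carrier G. \<forall>i\<in>F. y \<in> g i <# P (K i)"
  using assms
proof (induction F)
  case empty
  then show ?case by auto
next
  case (insert l F)
  then obtain y where y: "y \<in> carrier G" "\<And>i. i \<in> F \<Longrightarrow> y \<in> g i <# P (K i)"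
    by (metis insertCI)
  have coset: "g i <# P (K i) = y <# P (K i)" if "i \<in> F" for i
    using l_repr_independence y that insert.prems subgroup by simp
  have gl: "g l \<in> carrier G" and Kl: "K l \<subseteq> X" using insert.prems by auto
  interpret L: subgroup "P (K l)" G by (rule subgroup[OF Kl])
  have "inv (g l) \<otimes> y \<in> P (K l) <#> P (K i)" if i: "i \<in> F" for i
  proof -
    have "(y <# P (K i)) \<inter> (g l <# P (K l)) \<noteq> {}"
      using insert.prems(3)[of i l] i coset[OF i] by auto
    then obtain a b where ab: "a \<in> P (K i)" "b \<in> P (K l)" "y \<otimes> a = g l \<otimes> b"
      by (auto simp: l_coset_def)
    interpret I: subgroup "P (K i)" G using subgroup insert.prems(2) i by blast
    have "inv (g l) \<otimes> y = b \<otimes> inv a"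
      using ab y gl by (metis I.mem_carrier L.mem_carrier inv_closed inv_solve_left inv_solve_right m_assoc m_closed)
    then show ?thesis using ab by (auto simp: set_mult_def)
  qed
  then have "inv (g l) \<otimes> y \<in> P (K l) <#> P (X \<inter> (\<Inter>i\<in>F. K i))"
    using insert.prems insert.hyps y gl by (intro P_mult_Inter) auto
  then obtain b a where ab: "b \<in> P (K l)" "a \<in> P (X \<inter> (\<Inter>i\<in>F. K i))" "inv (g l) \<otimes> y = b \<otimes> a"
    by (auto simp: set_mult_def)
  have a: "a \<in> carrier G" using ab(2) mem_P_carrier by blast
  have "y \<otimes> inv a = g l \<otimes> b"
    using ab a y gl by (metis L.mem_carrier inv_closed inv_solve_left inv_solve_right m_assoc m_closed)
  then have "y \<otimes> inv a \<in> g l <# P (K l)" using ab(1) by (auto simp: l_coset_def)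
  moreover have "y \<otimes> inv a \<in> g i <# P (K i)" if i: "i \<in> F" for i
  proof -
    have Ki: "K i \<subseteq> X" using insert.prems(2) i by blast
    then have "a \<in> P (K i)" using ab(2) mono[OF _ Ki, of "X \<inter> (\<Inter>i\<in>F. K i)"] i by blast
    then have "inv a \<in> P (K i)" using subgroup.m_inv_closed[OF subgroup[OF Ki]] by blast
    then show ?thesis unfolding coset[OF i] by (auto simp: l_coset_def)
  qed
  ultimately show ?case using y a by (intro bexI[of _ "y \<otimes> inv a"]) auto
qed

lemma flag_coset_complex:
  assumes "finite X"
  shows "flag_complex (coset_vertices G (\<lambda>i. P (X - {i})) X) (coset_simplices G (\<lambda>i. P (X - {i})) X)"
    (is "flag_complex ?V ?S")
  unfolding flag_complex_def
proof (intro conjI allI impI)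
  show "simplicial_complex_on ?V ?S"
    by (rule coset_complex_simplicial) (auto intro: subgroup is_group)
  fix \<sigma> assume "\<sigma> \<subseteq> ?V \<and> (\<forall>u\<in>\<sigma>. \<forall>v\<in>\<sigma>. u \<noteq> v \<longrightarrow> {u, v} \<in> ?S)"
  then have sub: "\<sigma> \<subseteq> ?V" and edge: "\<And>u v. u \<in> \<sigma> \<Longrightarrow> v \<in> \<sigma> \<Longrightarrow> u \<noteq> v \<Longrightarrow> {u, v} \<in> ?S"
    by blast+
  have "\<exists>g. fst v \<in> X \<and> g \<in> carrier G \<and> snd v = g <# P (X - {fst v})" if "v \<in> \<sigma>" for v
  proof -
    have "v \<in> ?V" using sub that by blast
    then show ?thesis by (auto simp: coset_vertices_def)
  qed
  then obtain g where g: "\<And>v. v \<in> \<sigma> \<Longrightarrow> fst v \<in> X" "\<And>v. v \<in> \<sigma> \<Longrightarrow> g v \<in> carrier G"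
      "\<And>v. v \<in> \<sigma> \<Longrightarrow> snd v = g v <# P (X - {fst v})"
    by metis
  have sg: "subgroup (P (X - {i})) G" for i by (rule subgroup) auto
  have meet: "snd u \<inter> snd v \<noteq> {}" if uv: "u \<in> \<sigma>" "v \<in> \<sigma>" for u v
  proof (cases "u = v")
    case True
    have "g u \<otimes> \<one> \<in> snd u"
      unfolding g(3)[OF uv(1)] using subgroup.one_closed[OF sg] by (auto simp: l_coset_def)
    then show ?thesis using True by auto
  next
    case False
    then show ?thesis using edge[OF uv] by (simp add: coset_simplices_def)
  qed
  \<comment> \<open>Cosets of one type that meet coincide, so a clique has at most one vertex of
    each type and is finite, as a simplex must be.\<close>
  have "inj_on fst \<sigma>"
  proof (rule inj_onI)
    fix u v assume uv: "u \<in> \<sigma>" "v \<in> \<sigma>" "fst u = fst v"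
    obtain y where "y \<in> snd u" "y \<in> snd v" using meet[OF uv(1,2)] by blast
    then have "snd u = snd v"
      using l_repr_independence[OF _ g(2)[OF uv(1)] sg] l_repr_independence[OF _ g(2)[OF uv(2)] sg]
        g(3)[OF uv(1)] g(3)[OF uv(2)] uv(3) by metis
    then show "u = v" using uv(3) by (simp add: prod_eq_iff)
  qed
  moreover have "fst ` \<sigma> \<subseteq> X" using g(1) by blast
  ultimately have fin: "finite \<sigma>" using assms by (meson finite_imageD finite_subset)
  have "\<exists>y\<in>carrier G. \<forall>v\<in>\<sigma>. y \<in> g v <# P (X - {fst v})"
    by (rule cosets_Helly) (use fin g meet in auto)
  then obtain y where "\<And>v. v \<in> \<sigma> \<Longrightarrow> y \<in> snd v" using g(3) by blast
  then have "y \<in> (\<Inter>v\<in>\<sigma>. snd v)" by blast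
  then have "(\<Inter>v\<in>\<sigma>. snd v) \<noteq> {}" by blast
  then show "\<sigma> \<in> ?S" using fin sub by (simp add: coset_simplices_def)
qed

end

section \<open>Shephard groups\<close>

theorem theorem5p17:
  fixes n k :: nat and p :: "nat \<Rightarrow> nat \<Rightarrow> enat"
  assumes "n \<ge> 2" and "k \<ge> 2"
    and "\<And>i j. 1 \<le> i \<Longrightarrow> i < j \<Longrightarrow> j \<le> n - 1 \<Longrightarrow> p i j = p j i \<and> p i j \<ge> 2"
  shows "(\<forall>J K L. J \<subseteq> {0..n - 1} \<longrightarrow> K \<subseteq> {0..n - 1} \<longrightarrow> L \<subseteq> {0..n - 1} \<longrightarrow>
      shephard_subgroup n k p J \<inter> shephard_subgroup n k p K = shephard_subgroup n k p (J \<inter> K)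
    \<and> (shephard_subgroup n k p J <#>\<^bsub>shephard_group n k p\<^esub> shephard_subgroup n k p K)
        \<inter> (shephard_subgroup n k p J <#>\<^bsub>shephard_group n k p\<^esub> shephard_subgroup n k p L)
      = shephard_subgroup n k p J <#>\<^bsub>shephard_group n k p\<^esub>
          (shephard_subgroup n k p K \<inter> shephard_subgroup n k p L))
    \<and> flag_complex
        (coset_vertices (shephard_group n k p) (\<lambda>i. shephard_subgroup n k p ({0..n - 1} - {i})) {0..n - 1})
        (coset_simplices (shephard_group n k p) (\<lambda>i. shephard_subgroup n k p ({0..n - 1} - {i})) {0..n - 1})"
proof -
  let ?X = "{0..n - 1}" and ?R = "shephard_relations n k p" and ?G = "shephard_group n k p"
  let ?P = "shephard_subgroup n k p" and ?c = "\<lambda>u. pres_rel {0..n - 1} (shephard_relations n k p) `` {u}"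
  obtain r :: "nat \<Rightarrow> nat gword set bijection" where
    "\<forall>u\<in>words ?X. \<forall>v\<in>words ?X. word_sum r u = word_sum r v \<longleftrightarrow> pres_eq ?X (dyer_relations n k p) u v"
    using ex_faithful_word_sum by blast
  then interpret shephard n k p r
    using assms by unfold_locales auto
  have G: "?G = presented_group ?X ?R" by (simp add: shephard_group_def)
  have P: "?P J = ?c ` words J" if "J \<subseteq> ?X" for J
    using generate_pres_gen[OF that, of ?R]
    by (simp add: shephard_subgroup_def shephard_group_def shephard_gen_def)
  \<comment> \<open>An arbitrary representative is taken; \<open>pres_eq_retract\<close> at the
    state 0 makes the class of the result independent of it.\<close>
  define \<pi> where "\<pi> J A = ?c (retract J 0 (SOME u. u \<in> A))" for J A
  have \<pi>: "\<pi> J (?c u) = ?c (retract J 0 u)" if J: "J \<subseteq> ?X" and u: "u \<in> words ?X" for J u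
  proof -
    have "u \<in> ?c u" using u by (auto simp: pres_rel_def intro: pres_eq.refl)
    then have "(SOME v. v \<in> ?c u) \<in> ?c u" by (rule someI)
    then have "pres_eq ?X ?R u (SOME v. v \<in> ?c u)" by (simp add: pres_rel_def)
    moreover have "0 \<in> D J" using W_closed(1) by (simp add: D_def)
    ultimately have "pres_eq ?X ?R (retract J 0 u) (retract J 0 (SOME v. v \<in> ?c u))"
      using pres_eq_retract[OF J] by blast
    then show ?thesis
      unfolding \<pi>_def using pres_class_eq_iff pres_eq_words by metis
  qed
  interpret parabolic_retractions ?G ?X ?P \<pi>
  proof (intro parabolic_retractions.intro parabolic_retractions_axioms.intro)
    show group: "group ?G" unfolding G by (rule group_presented_group)
    show "subgroup (?P J) ?G" if J: "J \<subseteq> ?X" for J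
      unfolding shephard_subgroup_def
      by (rule group.generate_is_subgroup[OF group])
        (use J in \<open>auto simp: G shephard_gen_def intro!: pres_gen_closed\<close>)
    show "?P J \<subseteq> ?P K" if "J \<subseteq> K" "K \<subseteq> ?X" for J K
      using that words_mono[OF that(1)] by (auto simp: P)
    show "?P ?X = carrier ?G" by (simp add: P G pres_carrier)
    show "\<pi> J (h \<otimes>\<^bsub>?G\<^esub> g) = h \<otimes>\<^bsub>?G\<^esub> \<pi> J g" if J: "J \<subseteq> ?X" and h: "h \<in> ?P J" and g: "g \<in> carrier ?G" for J h g
    proof -
      obtain u v where u: "u \<in> words J" "h = ?c u" and v: "v \<in> words ?X" "g = ?c v"
        using g h by (auto simp: P[OF J] G pres_carrier)
      have "u \<in> words ?X" "retract J 0 v \<in> words ?X"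
        using words_mono[OF J] u(1) retract_in_words[OF J] by blast+
      then show ?thesis
        using u v retract_self[OF u(1) J] \<pi>[OF J, of "u @ v"] \<pi>[OF J, of v]
        by (simp add: G pres_mult_class retract_append)
    qed
    show "\<pi> J \<one>\<^bsub>?G\<^esub> = \<one>\<^bsub>?G\<^esub>" if "J \<subseteq> ?X" for J
      using \<pi>[OF that, of "[]"] by (simp add: G pres_one)
    show "\<pi> J g \<in> ?P (J \<inter> K)" if J: "J \<subseteq> ?X" and K: "K \<subseteq> ?X" and g: "g \<in> ?P K" for J K g
    proof -
      obtain u where u: "u \<in> words K" "g = ?c u" using g by (auto simp: P[OF K])
      have "0 \<in> ev ` words K" by (rule image_eqI[of _ _ "[]"]) auto
      then have "retract J 0 u \<in> words (J \<inter> K)" using retract_parabolic[OF J K u(1)] by blast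
      moreover have "J \<inter> K \<subseteq> ?X" using J by blast
      ultimately show ?thesis using \<pi>[OF J words_mono[OF K u(1)]] u(2) P by simp
    qed
  qed
  show ?thesis
    using P_Int P_mult_Int flag_coset_complex by simp
qed

end
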